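(* Let $M$ be a connected closed manifold with $H^1(M)=\{0\}$ and suppose that $K$ is a connected isolated non-saddle set of a flow on $M$. Then $K$ does not have dissonant points. Moreover, if $U$ is a component of $M-K$, then the flow restricted to $U$ is either locally attracted by $K$ (i.e. all points lying in $U$ near $K$ are attracted by $K$) or locally repelled by $K$. Furthermore, if $N$ is an isolating block of $K$ of the form $N=N^+\cup N^-$, then different components of $\partial N$ lie in different components of $M-K$. As a consequence, connected isolated non-saddle sets $K$ of flows in the Euclidean space $\mathbb{R}^n$, $n\geq 2$, have no dissonant points and the flow on every component of $\mathbb{R}^n-K$ is either locally attracted or locally repelled by $K$. In particular, if $\mathcal{I}(K)=\mathbb{R}^n$, then $K$ is a stable global attractor or a negatively stable global repeller.
   Context: A flow is a continuous action $\varphi:M\times\mathbb{R}\to M$; write $xt=\varphi(x,t)$, $\gamma(x)=\{xt\mid t\in\mathbb{R}\}$, $\gamma^+(x)=\{xt\mid t\ge 0\}$, $\gamma^-(x)=\{xt\mid t\le 0\}$, $\omega(x)=\bigcap_{t>0}\overline{x[t,\infty)}$, $\omega^*(x)=\bigcap_{t<0}\overline{x(-\infty,t]}$. An isolated invariant set is a compact invariant set $K$ (with $\emptyset\neq K\subsetneq M$) having an isolating neighborhood, i.e. a compact neighborhood $N$ such that $K$ is the maximal invariant set in $N$. A compact invariant set $K$ is saddle if it admits a neighborhood $U$ such that every neighborhood $V$ of $K$ contains a point $x\in V$ with $\gamma^+(x)\nsubseteq U$ and $\gamma^-(x)\nsubseteq U$; otherwise it is non-saddle. $\mathcal{A}(K)=\{x\mid\emptyset\neq\omega(x)\subset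 K\}$, $\mathcal{R}(K)=\{x\mid\emptyset\neq\omega^*(x)\subset K\}$, $\mathcal{I}(K)=\mathcal{A}(K)\cup\mathcal{R}(K)$. $U$ is locally attracted (resp. repelled) by $K$ if there is a neighborhood $V$ of $K$ with $U\cap V\subset\mathcal{A}(K)$ (resp. $U\cap V\subset\mathcal{R}(K)$). A stable global attractor is an asymptotically stable $K$ with $\mathcal{A}(K)=M$; a negatively stable global repeller is a stable global attractor of the reversed flow. Dissonant points: $J^+(x)=\bigcap_{U,\,t>0}\overline{U[t,\infty)}$ and $J^-(x)=\bigcap_{U,\,t<0}\overline{U(-\infty,t]}$, with $U$ ranging over neighborhoods of $x$, and $J^*(x)=\{(y,z)\in M\times M\mid \text{there are } x_n\to x,\ t_n\to\infty,\ s_n\to-\infty \text{ with } x_nt_n\to y,\ x_ns_n\to z\}$. A point $x\in\mathcal{I}(K)$ is positively dissonant if $x\notin\mathcal{A}(K)$ but $J^+(x)\cap K\neq\emptyset$, and negatively dissonant if $x\notin\mathcal{R}(K)$ but $J^-(x)\cap K\neq\emptyset$. A point $x\notin\mathcal{I}(K)$ is externally dissonant if $J^*(x)\cap(K\times K)\neq\emptyset$. A dissonant point is one of any of these three types. An isolating block is an isolating neighborhood $N$ for which there are compact sets $N^i,N^o\subset\partial N$ (entrance and exit sets) such that: (1) $\partial N=N^i\cup N^o$; (2) for each $x\in N^i$ there is $\varepsilon>0$ with $x[-\varepsilon,0)\subset M-N$, and for each $x\in N^o$ there is $\delta>0$ with $x(0,\delta]\subset M-N$; (3) for each $x\in\partial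 N-N^i$ there is $\varepsilon>0$ with $x[-\varepsilon,0)\subset\mathring{N}$, and for each $x\in\partial N-N^o$ there is $\delta>0$ with $x(0,\delta]\subset\mathring{N}$. Set $N^+=\{x\in N\mid\gamma^+(x)\subset N\}$, $N^-=\{x\in N\mid\gamma^-(x)\subset N\}$. $H^*$ denotes singular cohomology with integer coefficients; a closed manifold is a compact manifold without boundary. *)

theory Defs
  imports "HOL-Analysis.Analysis" "HOL-Homology.Homology"
begin

section \<open>Singular cohomology with integer coefficients\<close>

text \<open>Cochains are the homomorphisms from singular chains to the integers, represented
  extensionally so that equal cochains are equal functions.\<close>

definition cochain_group :: "nat \<Rightarrow> 'a topology \<Rightarrow> ('a chain \<Rightarrow> int) monoid" where
  "cochain_group p X =
     \<lparr>carrier = hom (chain_group p X) integer_group \<inter> extensional (singular_chain_set p X),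
      monoid.mult = (\<lambda>f g. \<lambda>c\<in>singular_chain_set p X. f c + g c),
      one = (\<lambda>c\<in>singular_chain_set p X. 0)\<rparr>"

definition coboundary :: "nat \<Rightarrow> 'a topology \<Rightarrow> ('a chain \<Rightarrow> int) \<Rightarrow> 'a chain \<Rightarrow> int" where
  "coboundary p X f = (\<lambda>c\<in>singular_chain_set (Suc p) X. f (chain_boundary (Suc p) c))"

definition cocycle_set :: "nat \<Rightarrow> 'a topology \<Rightarrow> ('a chain \<Rightarrow> int) set" where
  "cocycle_set p X = kernel (cochain_group p X) (cochain_group (Suc p) X) (coboundary p X)"

definition coboundary_set :: "nat \<Rightarrow> 'a topology \<Rightarrow> ('a chain \<Rightarrow> int) set" where
  "coboundary_set p X =
     (case p of 0 \<Rightarrow> {\<one>\<^bsub>cochain_group 0 X\<^esub>}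
              | Suc q \<Rightarrow> coboundary q X ` carrier (cochain_group q X))"

definition cohomology_group :: "nat \<Rightarrow> 'a topology \<Rightarrow> ('a chain \<Rightarrow> int) set monoid" where
  "cohomology_group p X =
     subgroup_generated (cochain_group p X) (cocycle_set p X) Mod coboundary_set p X"


section \<open>Closed manifolds\<close>

definition topological_manifold :: "nat \<Rightarrow> 'a topology \<Rightarrow> bool" where
  "topological_manifold n M \<longleftrightarrow>
     Hausdorff_space M \<and> second_countable M \<and>
     (\<forall>x\<in>topspace M. \<exists>U V. openin M U \<and> x \<in> U \<and> openin (Euclidean_space n) V \<and>
        subtopology M U homeomorphic_space subtopology (Euclidean_space n) V)"

definition closed_manifold :: "'a topology \<Rightarrow> bool" where
  "closed_manifold M \<longleftrightarrow> compact_space M \<and> (\<exists>n. topological_manifold n M)"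

definition nbhd_of :: "'a topology \<Rightarrow> 'a set \<Rightarrow> 'a set \<Rightarrow> bool" where
  "nbhd_of M S N \<longleftrightarrow> N \<subseteq> topspace M \<and> S \<subseteq> M interior_of N"


section \<open>Flows, orbits and limit sets\<close>

definition flow :: "'a topology \<Rightarrow> ('a \<Rightarrow> real \<Rightarrow> 'a) \<Rightarrow> bool" where
  "flow M \<phi> \<longleftrightarrow>
     continuous_map (prod_topology M euclideanreal) M (\<lambda>(x, t). \<phi> x t) \<and>
     (\<forall>x\<in>topspace M. \<phi> x 0 = x \<and> (\<forall>s t. \<phi> (\<phi> x s) t = \<phi> x (s + t)))"

definition orbit :: "('a \<Rightarrow> real \<Rightarrow> 'a) \<Rightarrow> 'a \<Rightarrow> 'a set" where
  "orbit \<phi> x = range (\<phi> x)"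

definition pos_orbit :: "('a \<Rightarrow> real \<Rightarrow> 'a) \<Rightarrow> 'a \<Rightarrow> 'a set" where
  "pos_orbit \<phi> x = \<phi> x ` {0..}"

definition neg_orbit :: "('a \<Rightarrow> real \<Rightarrow> 'a) \<Rightarrow> 'a \<Rightarrow> 'a set" where
  "neg_orbit \<phi> x = \<phi> x ` {..0}"

definition reversed_flow :: "('a \<Rightarrow> real \<Rightarrow> 'a) \<Rightarrow> 'a \<Rightarrow> real \<Rightarrow> 'a" where
  "reversed_flow \<phi> x t = \<phi> x (- t)"

definition omega_limit :: "'a topology \<Rightarrow> ('a \<Rightarrow> real \<Rightarrow> 'a) \<Rightarrow> 'a \<Rightarrow> 'a set" where
  "omega_limit M \<phi> x = (\<Inter>t\<in>{0<..}. M closure_of (\<phi> x ` {t..}))"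

definition neg_omega_limit :: "'a topology \<Rightarrow> ('a \<Rightarrow> real \<Rightarrow> 'a) \<Rightarrow> 'a \<Rightarrow> 'a set" where
  "neg_omega_limit M \<phi> x = (\<Inter>t\<in>{..<0}. M closure_of (\<phi> x ` {..t}))"


section \<open>Isolated invariant sets, saddle and non-saddle sets\<close>

definition invariant_set :: "'a topology \<Rightarrow> ('a \<Rightarrow> real \<Rightarrow> 'a) \<Rightarrow> 'a set \<Rightarrow> bool" where
  "invariant_set M \<phi> S \<longleftrightarrow> S \<subseteq> topspace M \<and> (\<forall>x\<in>S. orbit \<phi> x \<subseteq> S)"

definition isolating_nbhd ::
    "'a topology \<Rightarrow> ('a \<Rightarrow> real \<Rightarrow> 'a) \<Rightarrow> 'a set \<Rightarrow> 'a set \<Rightarrow> bool" where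
  "isolating_nbhd M \<phi> K N \<longleftrightarrow>
     compactin M N \<and> nbhd_of M K N \<and> invariant_set M \<phi> K \<and>
     (\<forall>S. invariant_set M \<phi> S \<and> S \<subseteq> N \<longrightarrow> S \<subseteq> K)"

definition isolated_invariant_set ::
    "'a topology \<Rightarrow> ('a \<Rightarrow> real \<Rightarrow> 'a) \<Rightarrow> 'a set \<Rightarrow> bool" where
  "isolated_invariant_set M \<phi> K \<longleftrightarrow>
     compactin M K \<and> invariant_set M \<phi> K \<and> K \<noteq> {} \<and> K \<noteq> topspace M \<and>
     (\<exists>N. isolating_nbhd M \<phi> K N)"

definition saddle_set :: "'a topology \<Rightarrow> ('a \<Rightarrow> real \<Rightarrow> 'a) \<Rightarrow> 'a set \<Rightarrow> bool" where
  "saddle_set M \<phi> K \<longleftrightarrow>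
     compactin M K \<and> invariant_set M \<phi> K \<and>
     (\<exists>U. nbhd_of M K U \<and>
        (\<forall>V. nbhd_of M K V \<longrightarrow>
           (\<exists>x\<in>V. \<not> pos_orbit \<phi> x \<subseteq> U \<and> \<not> neg_orbit \<phi> x \<subseteq> U)))"

definition nonsaddle_set :: "'a topology \<Rightarrow> ('a \<Rightarrow> real \<Rightarrow> 'a) \<Rightarrow> 'a set \<Rightarrow> bool" where
  "nonsaddle_set M \<phi> K \<longleftrightarrow>
     compactin M K \<and> invariant_set M \<phi> K \<and> \<not> saddle_set M \<phi> K"


section \<open>Attraction and repulsion\<close>

definition attraction_region :: "'a topology \<Rightarrow> ('a \<Rightarrow> real \<Rightarrow> 'a) \<Rightarrow> 'a set \<Rightarrow> 'a set" where
  "attraction_region M \<phi> K =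
     {x \<in> topspace M. omega_limit M \<phi> x \<noteq> {} \<and> omega_limit M \<phi> x \<subseteq> K}"

definition repulsion_region :: "'a topology \<Rightarrow> ('a \<Rightarrow> real \<Rightarrow> 'a) \<Rightarrow> 'a set \<Rightarrow> 'a set" where
  "repulsion_region M \<phi> K =
     {x \<in> topspace M. neg_omega_limit M \<phi> x \<noteq> {} \<and> neg_omega_limit M \<phi> x \<subseteq> K}"

definition influence_region :: "'a topology \<Rightarrow> ('a \<Rightarrow> real \<Rightarrow> 'a) \<Rightarrow> 'a set \<Rightarrow> 'a set" where
  "influence_region M \<phi> K = attraction_region M \<phi> K \<union> repulsion_region M \<phi> K"

definition locally_attracted ::
    "'a topology \<Rightarrow> ('a \<Rightarrow> real \<Rightarrow> 'a) \<Rightarrow> 'a set \<Rightarrow> 'a set \<Rightarrow> bool" where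
  "locally_attracted M \<phi> K U \<longleftrightarrow> (\<exists>V. nbhd_of M K V \<and> U \<inter> V \<subseteq> attraction_region M \<phi> K)"

definition locally_repelled ::
    "'a topology \<Rightarrow> ('a \<Rightarrow> real \<Rightarrow> 'a) \<Rightarrow> 'a set \<Rightarrow> 'a set \<Rightarrow> bool" where
  "locally_repelled M \<phi> K U \<longleftrightarrow> (\<exists>V. nbhd_of M K V \<and> U \<inter> V \<subseteq> repulsion_region M \<phi> K)"

definition stable_set :: "'a topology \<Rightarrow> ('a \<Rightarrow> real \<Rightarrow> 'a) \<Rightarrow> 'a set \<Rightarrow> bool" where
  "stable_set M \<phi> K \<longleftrightarrow>
     (\<forall>U. nbhd_of M K U \<longrightarrow> (\<exists>V. nbhd_of M K V \<and> (\<forall>x\<in>V. pos_orbit \<phi> x \<subseteq> U)))"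

definition asymptotically_stable ::
    "'a topology \<Rightarrow> ('a \<Rightarrow> real \<Rightarrow> 'a) \<Rightarrow> 'a set \<Rightarrow> bool" where
  "asymptotically_stable M \<phi> K \<longleftrightarrow>
     compactin M K \<and> invariant_set M \<phi> K \<and> stable_set M \<phi> K \<and>
     nbhd_of M K (attraction_region M \<phi> K)"

definition stable_global_attractor ::
    "'a topology \<Rightarrow> ('a \<Rightarrow> real \<Rightarrow> 'a) \<Rightarrow> 'a set \<Rightarrow> bool" where
  "stable_global_attractor M \<phi> K \<longleftrightarrow>
     asymptotically_stable M \<phi> K \<and> attraction_region M \<phi> K = topspace M"

definition neg_stable_global_repeller ::
    "'a topology \<Rightarrow> ('a \<Rightarrow> real \<Rightarrow> 'a) \<Rightarrow> 'a set \<Rightarrow> bool" where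
  "neg_stable_global_repeller M \<phi> K \<longleftrightarrow> stable_global_attractor M (reversed_flow \<phi>) K"


section \<open>Dissonant points\<close>

definition pos_prolongation :: "'a topology \<Rightarrow> ('a \<Rightarrow> real \<Rightarrow> 'a) \<Rightarrow> 'a \<Rightarrow> 'a set" where
  "pos_prolongation M \<phi> x =
     (\<Inter>U\<in>{U. nbhd_of M {x} U}. \<Inter>t\<in>{0<..}. M closure_of (\<Union>u\<in>U. \<phi> u ` {t..}))"

definition neg_prolongation :: "'a topology \<Rightarrow> ('a \<Rightarrow> real \<Rightarrow> 'a) \<Rightarrow> 'a \<Rightarrow> 'a set" where
  "neg_prolongation M \<phi> x =
     (\<Inter>U\<in>{U. nbhd_of M {x} U}. \<Inter>t\<in>{..<0}. M closure_of (\<Union>u\<in>U. \<phi> u ` {..t}))"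

definition joint_prolongation :: "'a topology \<Rightarrow> ('a \<Rightarrow> real \<Rightarrow> 'a) \<Rightarrow> 'a \<Rightarrow> ('a \<times> 'a) set" where
  "joint_prolongation M \<phi> x =
     {(y, z). \<exists>X t s. range X \<subseteq> topspace M \<and> limitin M X x sequentially \<and>
        filterlim t at_top sequentially \<and> filterlim s at_bot sequentially \<and>
        limitin M (\<lambda>n::nat. \<phi> (X n) (t n)) y sequentially \<and>
        limitin M (\<lambda>n. \<phi> (X n) (s n)) z sequentially}"

definition positively_dissonant ::
    "'a topology \<Rightarrow> ('a \<Rightarrow> real \<Rightarrow> 'a) \<Rightarrow> 'a set \<Rightarrow> 'a \<Rightarrow> bool" where
  "positively_dissonant M \<phi> K x \<longleftrightarrow>
     x \<in> influence_region M \<phi> K \<and> x \<notin> attraction_region M \<phi> K \<and>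
     pos_prolongation M \<phi> x \<inter> K \<noteq> {}"

definition negatively_dissonant ::
    "'a topology \<Rightarrow> ('a \<Rightarrow> real \<Rightarrow> 'a) \<Rightarrow> 'a set \<Rightarrow> 'a \<Rightarrow> bool" where
  "negatively_dissonant M \<phi> K x \<longleftrightarrow>
     x \<in> influence_region M \<phi> K \<and> x \<notin> repulsion_region M \<phi> K \<and>
     neg_prolongation M \<phi> x \<inter> K \<noteq> {}"

definition externally_dissonant ::
    "'a topology \<Rightarrow> ('a \<Rightarrow> real \<Rightarrow> 'a) \<Rightarrow> 'a set \<Rightarrow> 'a \<Rightarrow> bool" where
  "externally_dissonant M \<phi> K x \<longleftrightarrow>
     x \<in> topspace M \<and> x \<notin> influence_region M \<phi> K \<and>
     joint_prolongation M \<phi> x \<inter> (K \<times> K) \<noteq> {}"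

definition dissonant_point ::
    "'a topology \<Rightarrow> ('a \<Rightarrow> real \<Rightarrow> 'a) \<Rightarrow> 'a set \<Rightarrow> 'a \<Rightarrow> bool" where
  "dissonant_point M \<phi> K x \<longleftrightarrow>
     positively_dissonant M \<phi> K x \<or> negatively_dissonant M \<phi> K x \<or>
     externally_dissonant M \<phi> K x"


section \<open>Isolating blocks\<close>

definition isolating_block ::
    "'a topology \<Rightarrow> ('a \<Rightarrow> real \<Rightarrow> 'a) \<Rightarrow> 'a set \<Rightarrow> 'a set \<Rightarrow> bool" where
  "isolating_block M \<phi> K N \<longleftrightarrow>
     isolating_nbhd M \<phi> K N \<and>
     (\<exists>Ni No. compactin M Ni \<and> compactin M No \<and>
        M frontier_of N = Ni \<union> No \<and>
        (\<forall>x\<in>Ni. \<exists>\<epsilon>>0. \<phi> x ` {- \<epsilon>..<0} \<subseteq> topspace M - N) \<and>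
        (\<forall>x\<in>No. \<exists>\<delta>>0. \<phi> x ` {0<..\<delta>} \<subseteq> topspace M - N) \<and>
        (\<forall>x\<in>M frontier_of N - Ni. \<exists>\<epsilon>>0. \<phi> x ` {- \<epsilon>..<0} \<subseteq> M interior_of N) \<and>
        (\<forall>x\<in>M frontier_of N - No. \<exists>\<delta>>0. \<phi> x ` {0<..\<delta>} \<subseteq> M interior_of N))"

definition pos_part :: "('a \<Rightarrow> real \<Rightarrow> 'a) \<Rightarrow> 'a set \<Rightarrow> 'a set" where
  "pos_part \<phi> N = {x \<in> N. pos_orbit \<phi> x \<subseteq> N}"

definition neg_part :: "('a \<Rightarrow> real \<Rightarrow> 'a) \<Rightarrow> 'a set \<Rightarrow> 'a set" where
  "neg_part \<phi> N = {x \<in> N. neg_orbit \<phi> x \<subseteq> N}"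

definition components_in :: "'a topology \<Rightarrow> 'a set \<Rightarrow> 'a set set" where
  "components_in M S = connected_components_of (subtopology M S)"

end

theory Submission
  imports Defs
begin

text \<open>Write \<open>N\<^sup>+\<close> and \<open>N\<^sup>-\<close> for the points of an isolating neighbourhood \<open>N\<close> of \<open>K\<close> whose forward,
respectively backward, orbit stays in \<open>N\<close>.  Both sets are closed and they meet exactly in \<open>K\<close>.
If \<open>K\<close> is non-saddle, some open connected \<open>W \<supseteq> K\<close> lies in \<open>N\<^sup>+ \<union> N\<^sup>-\<close>; hence \<open>W - K\<close> splits into two
disjoint open pieces, a piece of attracted points and a piece of repelled points.

The whole theorem rests on one topological fact, \<open>no_component_meets_both_sides\<close>: when \<open>W\<close>
is a path connected open set containing \<open>K\<close> and \<open>W - K = P \<union> Q\<close> with \<open>P\<close>, \<open>Q\<close> open and disjoint, no component of \<open>M - K\<close> can meet both \<open>P\<close> and \<open>Q\<close>.  If one did, a loop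
could leave \<open>K\<close> through \<open>P\<close>, travel in that component and come back through \<open>Q\<close>.  A map from \<open>M\<close> to
the circle which runs once around the circle while crossing \<open>P\<close> outwards, and is constant
elsewhere, would then have degree one on this loop and so would not lift to the reals; but
\<open>H\<^sup>1(M) = 0\<close> makes every map to the circle lift.  In a Euclidean space maps to the circle lift
because the space is contractible.  The property \<open>circle_lifting\<close> isolates what the two cases share.

Consequently every component \<open>U\<close> of \<open>M - K\<close> is one-sided: near \<open>K\<close> it lies in \<open>N\<^sup>+\<close> or in \<open>N\<^sup>-\<close>.
This is the local attraction or repulsion.  It also excludes dissonance.  Say \<open>U\<close> lies in
\<open>N\<^sup>+\<close> near \<open>K\<close>.  If points near \<open>x \<in> U\<close> could reach \<open>W\<close> at arbitrarily early times, they would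
stay in \<open>N\<close> from those times on, and the entire orbit of \<open>x\<close> would lie in \<open>N\<close>, that is \<open>x \<in> K\<close>
(\<open>in_K_if_early_entries_accumulate\<close>).  So the negative prolongation of \<open>x\<close> misses \<open>K\<close>, and each type of
dissonance fails.  The repelled case is the same statement for the reversed flow.

For an isolating block \<open>N = N\<^sup>+ \<union> N\<^sup>-\<close> the same topological fact is applied to another splitting.  The
orbit of a point of \<open>N - K\<close> meets \<open>\<partial>N\<close> once before falling into \<open>K\<close> or after emerging from it, so a
separation \<open>\<partial>N = A \<union> B\<close> of two components of \<open>\<partial>N\<close> induces a separation of \<open>N - K\<close>
(\<open>frontier_components_separated\<close>).

If \<open>\<I>(K) = \<real>\<^sup>n\<close>, no component of the complement can lie in a compact set: a limit point of a
backward orbit in an attracted component is itself attracted or repelled, and therefore sends nearby points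
of that orbit into \<open>W\<close> at arbitrarily early times.  For \<open>n \<ge> 2\<close> the outside of a large cube is
connected, so the complement of \<open>K\<close> is a single component, which is attracted or repelled as a whole; stability of
\<open>K\<close> is then another consequence of the non-saddle condition.\<close>

section \<open>Integer corrections of circle-valued functions\<close>

text \<open>A map \<open>M \<rightarrow> S\<^sup>1\<close> is represented by an angle \<open>g\<close>, measured in turns and possibly discontinuous; a
lift to the reals differs from \<open>g\<close> by an integer-valued function \<open>h\<close>.  Continuity of the lift along
paths is enough for comparing its values at the two ends of a path.\<close>

definition circle_lifting :: "'a topology \<Rightarrow> bool" where
  "circle_lifting M \<longleftrightarrow>
     (\<forall>g. continuous_map M euclidean (\<lambda>x. cis (2 * pi * g x)) \<longrightarrow>
        (\<exists>h :: 'a \<Rightarrow> int. \<forall>p. pathin M p \<longrightarrow>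
            continuous_on {0..1} (\<lambda>t. g (p t) + real_of_int (h (p t)))))"

lemma continuous_integer_valued_constant:
  fixes d :: "'b::topological_space \<Rightarrow> int"
  assumes "connected S" "continuous_on S (\<lambda>z. real_of_int (d z))" "x \<in> S" "y \<in> S"
  shows "d x = d y"
proof -
  have "(\<lambda>z. real_of_int (d z)) constant_on S"
    using assms(1,2)
  proof (rule continuous_discrete_range_constant)
    fix x assume "x \<in> S"
    have "1 \<le> norm (real_of_int (d y) - real_of_int (d x))"
      if "real_of_int (d y) \<noteq> real_of_int (d x)" for y
      using that by (simp flip: of_int_diff of_int_abs)
    then show "\<exists>e>0. \<forall>y. y \<in> S \<and> real_of_int (d y) \<noteq> real_of_int (d x) \<longrightarrow>
        e \<le> norm (real_of_int (d y) - real_of_int (d x))"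
      by (intro exI[of _ 1]) auto
  qed
  then show ?thesis
    using assms(3,4) unfolding constant_on_def by (metis of_int_eq_iff)
qed

text \<open>Two continuous lifts of the same circle-valued function differ by a continuous function with
integer values.\<close>

lemma integer_shift_difference_constant:
  fixes u :: "'b::topological_space \<Rightarrow> real" and k l :: "'b \<Rightarrow> int"
  assumes "connected S"
    and "continuous_on S (\<lambda>z. u z + real_of_int (k z))"
    and "continuous_on S (\<lambda>z. u z + real_of_int (l z))"
    and "x \<in> S" "y \<in> S"
  shows "k x - k y = l x - l y"
proof -
  have "continuous_on S (\<lambda>z. (u z + real_of_int (k z)) - (u z + real_of_int (l z)))"
    by (intro continuous_on_diff assms)
  then have "continuous_on S (\<lambda>z. real_of_int (k z - l z))"
    by simp
  then have "k x - l x = k y - l y"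
    using continuous_integer_valued_constant[OF assms(1) _ assms(4,5), of "\<lambda>z. k z - l z"] by simp
  then show ?thesis by simp
qed

text \<open>A convex set is contractible, so the circle-valued function has a continuous logarithm there; its
imaginary part, divided by \<open>2\<pi>\<close>, is \<open>u\<close> up to integers.\<close>

lemma integer_shift_exists_on_convex:
  fixes u :: "'b::real_normed_vector \<Rightarrow> real"
  assumes "convex S" "continuous_on S (\<lambda>z. cis (2 * pi * u z))"
  obtains k :: "'b \<Rightarrow> int" where "continuous_on S (\<lambda>z. u z + real_of_int (k z))"
proof -
  obtain G where G: "continuous_on S G" "\<And>z. z \<in> S \<Longrightarrow> cis (2 * pi * u z) = exp (G z)"
    using continuous_logarithm_on_contractible[OF assms(2) convex_imp_contractible[OF assms(1)]]
    by (metis norm_cis norm_zero zero_neq_one)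
  have "\<exists>k::int. Im (G z) / (2 * pi) = u z + real_of_int k" if "z \<in> S" for z
  proof -
    have "exp (\<i> * complex_of_real (2 * pi * u z)) = exp (G z)"
      using G(2)[OF that] by (simp only: cis_conv_exp)
    then obtain k :: int
      where "\<i> * complex_of_real (2 * pi * u z) = G z + complex_of_real (real_of_int (2 * k) * pi) * \<i>"
      unfolding exp_eq by auto
    then have "2 * pi * u z = Im (G z) + 2 * pi * real_of_int k"
      by (simp add: complex_eq_iff)
    then have "Im (G z) / (2 * pi) = u z + real_of_int (- k)"
      by (simp add: field_simps)
    then show ?thesis by blast
  qed
  then obtain k where k: "\<And>z. z \<in> S \<Longrightarrow> Im (G z) / (2 * pi) = u z + real_of_int (k z)"
    by metis
  have "continuous_on S (\<lambda>z. Im (G z) / (2 * pi))"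
    by (intro continuous_intros G) auto
  then have "continuous_on S (\<lambda>z. u z + real_of_int (k z))"
    by (rule continuous_on_eq) (simp add: k)
  then show thesis by (rule that)
qed

text \<open>The increment over the unit interval of a continuous lift minus that of the representing angle
\<open>u\<close>.  Unlike the increment of the lift it is an integer, so that it can serve as the value of an
integral cochain.\<close>

definition jump :: "(real \<Rightarrow> real) \<Rightarrow> int" where
  "jump u = (SOME j. \<exists>k :: real \<Rightarrow> int.
     continuous_on {0..1} (\<lambda>t. u t + real_of_int (k t)) \<and> j = k 1 - k 0)"

lemma jump_eq:
  fixes k :: "real \<Rightarrow> int"
  assumes "continuous_on {0..1} (\<lambda>t. u t + real_of_int (k t))"
  shows "jump u = k 1 - k 0"
  unfolding jump_def
proof (rule some_equality)
  fix j assume "\<exists>l :: real \<Rightarrow> int. continuous_on {0..1} (\<lambda>t. u t + real_of_int (l t)) \<and> j = l 1 - l 0"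
  then show "j = k 1 - k 0"
    using integer_shift_difference_constant[OF _ _ assms, of _ 1 0] by auto
qed (use assms in blast)

section \<open>Circle-valued maps on spaces with trivial first cohomology\<close>

text \<open>The free abelian group of singular 1-chains allows \<open>w\<close> to be extended to a cochain.  The hypothesis says
that its coboundary vanishes on the generators of the 2-chains, hence the cochain is a cocycle, and
triviality of the quotient group turns it into a coboundary; \<open>h\<close> is the restriction of the
bounding 0-cochain to the generators.\<close>

lemma coboundary_if_trivial_cohomology:
  fixes w :: "((nat \<Rightarrow> real) \<Rightarrow> 'a) \<Rightarrow> int"
  assumes triv: "trivial_group (cohomology_group 1 X)"
    and w: "\<And>\<sigma>. singular_simplex 2 X \<sigma> \<Longrightarrow>
              w (singular_face 2 0 \<sigma>) - w (singular_face 2 1 \<sigma>) + w (singular_face 2 2 \<sigma>) = 0"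
  obtains h where "\<And>\<sigma>. singular_simplex 1 X \<sigma> \<Longrightarrow>
              w \<sigma> = h (singular_face 1 0 \<sigma>) - h (singular_face 1 1 \<sigma>)"
proof -
  let ?C = "\<lambda>p. chain_group p X"
  interpret Z: comm_group integer_group by (rule abelian_integer_group)
  obtain F where F: "F \<in> hom (?C 1) integer_group"
    and Fw: "\<And>\<sigma>. singular_simplex 1 X \<sigma> \<Longrightarrow> F (frag_of \<sigma>) = w \<sigma>"
    using Z.free_Abelian_group_universal[of w "singular_simplex_set 1 X"]
    unfolding chain_group_def by auto
  have hom_diff: "f (a - b) = f a - f b"
    if "f \<in> hom (?C p) integer_group" "singular_chain p X a" "singular_chain p X b" for f p a b
  proof -
    have "f ((a - b) + b) = f (a - b) + f b"
      using that hom_mult[OF that(1), of "a - b" b] by (simp add: singular_chain_diff)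
    then show ?thesis by simp
  qed
  define f where "f = restrict F (singular_chain_set 1 X)"
  have fF: "f c = F c" if "singular_chain 1 X c" for c
    using that by (simp add: f_def)
  have f: "f \<in> carrier (cochain_group 1 X)"
    using F unfolding cochain_group_def f_def
    by (auto simp: hom_def singular_chain_add)
  have cocycle: "F (chain_boundary 2 c) = 0" if "singular_chain 2 X c" for c
    using that[unfolded singular_chain_def]
  proof -
    from that have "singular_chain 2 X c \<and> F (chain_boundary 2 c) = 0"
      unfolding singular_chain_def
    proof (induction rule: frag_induction)
      case zero
      have "F (0 - 0) = 0" using hom_diff[OF F, of 0 0] by simp
      then show ?case by simp
    next
      case (one \<sigma>)
      then have s: "singular_simplex 2 X \<sigma>" by simp
      have face: "singular_simplex 1 X (singular_face 2 k \<sigma>)" if "k \<le> 2" for k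
        using singular_simplex_singular_face[OF s, of k] that by simp
      have ch: "singular_chain 1 X (frag_of (singular_face 2 k \<sigma>))" if "k \<le> 2" for k
        using face[OF that] by (simp add: singular_chain_of)
      have "chain_boundary 2 (frag_of \<sigma>) =
        (frag_of (singular_face 2 0 \<sigma>) - frag_of (singular_face 2 1 \<sigma>)) - (0 - frag_of (singular_face 2 2 \<sigma>))"
        by (simp add: chain_boundary_def numeral_2_eq_2)
      moreover have "F (frag_of (singular_face 2 0 \<sigma>) - frag_of (singular_face 2 1 \<sigma>))
          = w (singular_face 2 0 \<sigma>) - w (singular_face 2 1 \<sigma>)"
        using hom_diff[OF F ch[of 0] ch[of 1]] Fw[OF face[of 0]] Fw[OF face[of 1]] by simp
      moreover have "F (0 - frag_of (singular_face 2 2 \<sigma>)) = - w (singular_face 2 2 \<sigma>)"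
        using hom_diff[OF F singular_chain_0 ch[of 2]] hom_diff[OF F singular_chain_0 singular_chain_0]
          Fw[OF face[of 2]] by simp
      moreover have "F ((frag_of (singular_face 2 0 \<sigma>) - frag_of (singular_face 2 1 \<sigma>)) -
            (0 - frag_of (singular_face 2 2 \<sigma>)))
          = F (frag_of (singular_face 2 0 \<sigma>) - frag_of (singular_face 2 1 \<sigma>)) -
            F (0 - frag_of (singular_face 2 2 \<sigma>))"
        using ch[of 0] ch[of 1] ch[of 2]
        by (intro hom_diff[OF F] singular_chain_diff singular_chain_0) simp_all
      ultimately have "F (chain_boundary 2 (frag_of \<sigma>)) =
          w (singular_face 2 0 \<sigma>) - w (singular_face 2 1 \<sigma>) + w (singular_face 2 2 \<sigma>)"
        by simp
      then show ?case using w[OF s] s by simp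
    next
      case (diff a b)
      then have "singular_chain 1 X (chain_boundary 2 a)" "singular_chain 1 X (chain_boundary 2 b)"
        using singular_chain_boundary[of 2 X] by (auto simp: singular_chain_def)
      then show ?case
        using diff hom_diff[OF F] singular_chain_diff[of 2 X a b]
        by (simp add: chain_boundary_diff singular_chain_def)
    qed
    then show ?thesis by simp
  qed
  have "f \<in> cocycle_set 1 X"
  proof -
    have "coboundary 1 X f = \<one>\<^bsub>cochain_group (Suc 1) X\<^esub>"
    proof
      fix c
      show "coboundary 1 X f c = \<one>\<^bsub>cochain_group (Suc 1) X\<^esub> c"
      proof (cases "singular_chain 2 X c")
        case True
        then have "singular_chain 1 X (chain_boundary 2 c)"
          using singular_chain_boundary[of 2 X c] by simp
        then show ?thesis
          using True cocycle[OF True] fF by (simp add: coboundary_def cochain_group_def numeral_2_eq_2)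
      next
        case False
        then show ?thesis by (simp add: coboundary_def cochain_group_def numeral_2_eq_2)
      qed
    qed
    then show ?thesis using f by (simp add: cocycle_set_def kernel_def)
  qed
  then have "f \<in> carrier (subgroup_generated (cochain_group 1 X) (cocycle_set 1 X))"
    using f by (auto simp: subgroup_generated_def carrier_subgroup_generated generate.incl)
  \<comment> \<open>The only coset in the trivial quotient is that of the unit.\<close>
  then have "coboundary_set 1 X #>\<^bsub>subgroup_generated (cochain_group 1 X) (cocycle_set 1 X)\<^esub> f
      = coboundary_set 1 X"
    using triv unfolding cohomology_group_def trivial_group_def FactGroup_def
    by (auto simp: RCOSETS_def)
  moreover have "\<one>\<^bsub>cochain_group 1 X\<^esub> \<in> coboundary_set 1 X"
  proof -
    have "coboundary 0 X \<one>\<^bsub>cochain_group 0 X\<^esub> = \<one>\<^bsub>cochain_group 1 X\<^esub>"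
      using singular_chain_boundary[of 1 X] by (auto simp: coboundary_def cochain_group_def fun_eq_iff restrict_def)
    moreover have "\<one>\<^bsub>cochain_group 0 X\<^esub> \<in> carrier (cochain_group 0 X)"
      by (auto simp: cochain_group_def hom_def singular_chain_add)
    ultimately show ?thesis
      unfolding coboundary_set_def One_nat_def nat.case by (metis image_eqI One_nat_def)
  qed
  moreover have "\<one>\<^bsub>cochain_group 1 X\<^esub> \<otimes>\<^bsub>cochain_group 1 X\<^esub> f = f"
    using f by (auto simp: cochain_group_def fun_eq_iff restrict_def extensional_def)
  ultimately have "f \<in> coboundary_set 1 X"
    unfolding r_coset_def subgroup_generated_def by force
  then obtain g where g: "g \<in> carrier (cochain_group 0 X)" and fg: "f = coboundary 0 X g"
    by (auto simp: coboundary_set_def)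
  have ghom: "g \<in> hom (?C 0) integer_group"
    using g by (simp add: cochain_group_def)
  show thesis
  proof
    fix \<sigma> assume s: "singular_simplex 1 X \<sigma>"
    have ch: "singular_chain 0 X (frag_of (singular_face 1 k \<sigma>))" if "k \<le> 1" for k
      using singular_simplex_singular_face[OF s, of k] that by (simp add: singular_chain_of)
    have "w \<sigma> = f (frag_of \<sigma>)"
      using s by (simp add: fF Fw singular_chain_of)
    also have "\<dots> = g (chain_boundary 1 (frag_of \<sigma>))"
      using s by (simp add: fg coboundary_def singular_chain_of)
    also have "chain_boundary 1 (frag_of \<sigma>) = frag_of (singular_face 1 0 \<sigma>) - frag_of (singular_face 1 1 \<sigma>)"
      by (simp add: chain_boundary_def)
    finally show "w \<sigma> = (g \<circ> frag_of) (singular_face 1 0 \<sigma>) - (g \<circ> frag_of) (singular_face 1 1 \<sigma>)"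
      using hom_diff[OF ghom ch ch, of 0 1] by simp
  qed
qed

lemma integer_shift_exists_along_map:
  fixes T :: "'b::real_normed_vector \<Rightarrow> 'a" and g :: "'a \<Rightarrow> real"
  assumes "continuous_map M euclidean (\<lambda>x. cis (2 * pi * g x))"
    and "convex S" "continuous_map (top_of_set S) M T"
  obtains k :: "'b \<Rightarrow> int" where "continuous_on S (\<lambda>z. g (T z) + real_of_int (k z))"
proof -
  have "continuous_map (top_of_set S) euclidean ((\<lambda>x. cis (2 * pi * g x)) \<circ> T)"
    by (rule continuous_map_compose[OF assms(3,1)])
  then have "continuous_on S (\<lambda>z. cis (2 * pi * g (T z)))"
    by (simp add: o_def)
  then show thesis
    by (rule integer_shift_exists_on_convex[OF assms(2)]) (rule that)
qed

lemma standard_simplex_0_eq: "standard_simplex 0 = {\<lambda>i. if i = 0 then 1 else 0}"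
proof -
  have "x = (\<lambda>i. if i = 0 then 1 else 0)" if "x \<in> standard_simplex 0" for x
    using that by (intro ext) (auto simp: standard_simplex_def)
  then show ?thesis
    by (auto simp: standard_simplex_def)
qed

text \<open>Faces of singular simplices are restricted to the standard simplex, so the singular 0-simplex at
\<open>x\<close> has to be restricted as well.\<close>

definition vertex :: "'a \<Rightarrow> (nat \<Rightarrow> real) \<Rightarrow> 'a" where
  "vertex x = restrict (\<lambda>_. x) (standard_simplex 0)"

definition edge_point :: "real \<Rightarrow> nat \<Rightarrow> real" where
  "edge_point t = (\<lambda>i. if i = 0 then 1 - t else if i = 1 then t else 0)"

definition triangle_point :: "real \<times> real \<Rightarrow> nat \<Rightarrow> real" where
  "triangle_point z = (\<lambda>i. if i = 0 then 1 - fst z - snd z else if i = 1 then fst z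
      else if i = 2 then snd z else 0)"

lemma edge_point_in: "t \<in> {0..1} \<Longrightarrow> edge_point t \<in> standard_simplex 1"
  by (auto simp: edge_point_def standard_simplex_def)

lemma triangle_point_in:
  assumes "0 \<le> a" "0 \<le> b" "a + b \<le> 1"
  shows "triangle_point (a, b) \<in> standard_simplex 2"
  using assms by (auto simp: triangle_point_def standard_simplex_def numeral_2_eq_2)

definition path_simplex :: "(real \<Rightarrow> 'a) \<Rightarrow> (nat \<Rightarrow> real) \<Rightarrow> 'a" where
  "path_simplex p = restrict (\<lambda>x. p (x 1)) (standard_simplex 1)"

lemma singular_simplex_path_simplex:
  assumes "pathin X p"
  shows "singular_simplex 1 X (path_simplex p)"
proof -
  let ?S = "subtopology (powertop_real UNIV) (standard_simplex 1)"
  have "continuous_map ?S (top_of_set {0..1}) (\<lambda>x. x 1)"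
    unfolding continuous_map_in_subtopology
    by (auto intro!: continuous_map_from_subtopology continuous_map_product_projection
        simp: standard_simplex_def)
  then have "continuous_map ?S X (p \<circ> (\<lambda>x. x 1))"
    using assms unfolding pathin_def by (rule continuous_map_compose)
  then show ?thesis
    unfolding singular_simplex_def path_simplex_def
    by (auto elim!: continuous_map_eq)
qed

lemma path_simplex_edge_point: "t \<in> {0..1} \<Longrightarrow> path_simplex p (edge_point t) = p t"
  using edge_point_in[of t] by (simp add: path_simplex_def) (simp add: edge_point_def)

lemma singular_face_path_simplex:
  "singular_face 1 0 (path_simplex p) = vertex (p 1)"
  "singular_face 1 1 (path_simplex p) = vertex (p 0)"
proof -
  have "simplical_face 0 (\<lambda>i. if i = 0 then 1 else 0) = edge_point 1"
    "simplical_face 1 (\<lambda>i. if i = 0 then 1 else 0) = edge_point 0"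
    by (auto simp: simplical_face_def edge_point_def fun_eq_iff)
  then show "singular_face 1 0 (path_simplex p) = vertex (p 1)"
    "singular_face 1 1 (path_simplex p) = vertex (p 0)"
    using path_simplex_edge_point[of 1 p] path_simplex_edge_point[of 0 p]
    by (auto simp: singular_face_def vertex_def standard_simplex_0_eq
        simp del: One_nat_def intro!: restrict_ext)
qed

lemma singular_face_edge_point:
  assumes "t \<in> {0..1}"
  shows "singular_face 2 0 \<sigma> (edge_point t) = \<sigma> (triangle_point (1 - t, t))"
    and "singular_face 2 1 \<sigma> (edge_point t) = \<sigma> (triangle_point (0, t))"
    and "singular_face 2 2 \<sigma> (edge_point t) = \<sigma> (triangle_point (t, 0))"
proof -
  have "simplical_face 0 (edge_point t) = triangle_point (1 - t, t)"
    "simplical_face 1 (edge_point t) = triangle_point (0, t)"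
    "simplical_face 2 (edge_point t) = triangle_point (t, 0)"
    by (auto simp: simplical_face_def edge_point_def triangle_point_def fun_eq_iff)
  then show "singular_face 2 0 \<sigma> (edge_point t) = \<sigma> (triangle_point (1 - t, t))"
    "singular_face 2 1 \<sigma> (edge_point t) = \<sigma> (triangle_point (0, t))"
    "singular_face 2 2 \<sigma> (edge_point t) = \<sigma> (triangle_point (t, 0))"
    using edge_point_in[OF assms] by (simp_all add: singular_face_def)
qed

lemma continuous_map_triangle_point:
  assumes "singular_simplex 2 X \<sigma>"
  shows "continuous_map (top_of_set {(a, b). 0 \<le> a \<and> 0 \<le> b \<and> a + b \<le> 1}) X (\<sigma> \<circ> triangle_point)"
proof (rule continuous_map_compose)
  show "continuous_map (subtopology (powertop_real UNIV) (standard_simplex 2)) X \<sigma>"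
    using assms by (simp add: singular_simplex_def)
  have "continuous_on UNIV (\<lambda>z. triangle_point z i)" for i
    unfolding triangle_point_def
    by (cases "i = 0"; cases "i = 1"; cases "i = 2") (auto intro!: continuous_intros)
  then have "continuous_on S (\<lambda>z. triangle_point z i)" for i S
    using continuous_on_subset by blast
  then show "continuous_map (top_of_set {(a, b). 0 \<le> a \<and> 0 \<le> b \<and> a + b \<le> 1})
      (subtopology (powertop_real UNIV) (standard_simplex 2)) triangle_point"
    by (auto simp: continuous_map_in_subtopology continuous_map_componentwise_UNIV triangle_point_in)
qed

text \<open>A singular triangle is the image of a convex set, so the circle-valued function has one lift on the whole
triangle.  The jumps along the three edges are differences of its integer corrections at the
vertices and cancel.\<close>

lemma jump_edge_cocycle:
  assumes g: "continuous_map X euclidean (\<lambda>x. cis (2 * pi * g x))"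
    and \<sigma>: "singular_simplex 2 X \<sigma>"
  defines "w \<equiv> \<lambda>\<tau>. jump (\<lambda>t. g (\<tau> (edge_point t)))"
  shows "w (singular_face 2 0 \<sigma>) - w (singular_face 2 1 \<sigma>) + w (singular_face 2 2 \<sigma>) = 0"
proof -
  let ?S = "{(a, b). 0 \<le> a \<and> 0 \<le> b \<and> a + b \<le> (1::real)}"
  have "convex ?S"
  proof -
    have "?S = {z. (-1, 0) \<bullet> z \<le> 0} \<inter> {z. (0, -1) \<bullet> z \<le> 0} \<inter> {z. (1, 1) \<bullet> z \<le> 1}"
      by (auto simp: inner_prod_def)
    then show ?thesis by (simp add: convex_Int convex_halfspace_le)
  qed
  then obtain k where k: "continuous_on ?S (\<lambda>z. g ((\<sigma> \<circ> triangle_point) z) + real_of_int (k z))"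
    using integer_shift_exists_along_map[OF g _ continuous_map_triangle_point[OF \<sigma>]] by blast
  have along: "w \<tau> = k (e 1) - k (e 0)"
    if "continuous_on {0..1} e" "e ` {0..1} \<subseteq> ?S"
      "\<And>t. t \<in> {0..1} \<Longrightarrow> \<tau> (edge_point t) = \<sigma> (triangle_point (e t))" for \<tau> e
  proof -
    have "continuous_on {0..1} (\<lambda>t. g ((\<sigma> \<circ> triangle_point) (e t)) + real_of_int (k (e t)))"
      using continuous_on_compose2[OF k that(1,2)] .
    then have "continuous_on {0..1} (\<lambda>t. g (\<tau> (edge_point t)) + real_of_int ((k \<circ> e) t))"
      by (rule continuous_on_eq) (simp add: that(3))
    from jump_eq[OF this] show ?thesis by (simp add: w_def)
  qed
  have "w (singular_face 2 0 \<sigma>) = k (0, 1) - k (1, 0)"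
    by (subst along[of "\<lambda>t. (1 - t, t)"])
      (auto simp: singular_face_edge_point simp del: One_nat_def intro!: continuous_intros)
  moreover have "w (singular_face 2 1 \<sigma>) = k (0, 1) - k (0, 0)"
    by (subst along[of "\<lambda>t. (0, t)"])
      (auto simp: singular_face_edge_point simp del: One_nat_def intro!: continuous_intros)
  moreover have "w (singular_face 2 2 \<sigma>) = k (1, 0) - k (0, 0)"
    by (subst along[of "\<lambda>t. (t, 0)"])
      (auto simp: singular_face_edge_point simp del: One_nat_def intro!: continuous_intros)
  ultimately show ?thesis by simp
qed

text \<open>The jumps along paths form a 1-cocycle, so they are differences \<open>h(p(1)) - h(p(0))\<close>.  Applying this to
all initial segments of a path \<open>p\<close> shows that \<open>h \<circ> p\<close> agrees, up to a constant, with the integer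
correction of a continuous lift along \<open>p\<close>.\<close>

lemma circle_lifting_if_trivial_cohomology:
  assumes "trivial_group (cohomology_group 1 M)"
  shows "circle_lifting M"
  unfolding circle_lifting_def
proof (intro allI impI)
  fix g :: "'a \<Rightarrow> real"
  assume g: "continuous_map M euclidean (\<lambda>x. cis (2 * pi * g x))"
  let ?w = "\<lambda>\<tau>. jump (\<lambda>t. g (\<tau> (edge_point t)))"
  obtain h0 where h0: "\<And>\<sigma>. singular_simplex 1 M \<sigma> \<Longrightarrow>
      ?w \<sigma> = h0 (singular_face 1 0 \<sigma>) - h0 (singular_face 1 1 \<sigma>)"
    by (rule coboundary_if_trivial_cohomology[of M ?w, OF assms jump_edge_cocycle[OF g]]) (assumption, rule that)
  have "continuous_on {0..1} (\<lambda>t. g (p t) + real_of_int (h0 (vertex (p t))))" if p: "pathin M p" for p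
  proof -
    obtain k where k: "continuous_on {0..1} (\<lambda>t. g (p t) + real_of_int (k t))"
      by (rule integer_shift_exists_along_map[OF g convex_real_interval(5) p[unfolded pathin_def]])
    \<comment> \<open>The initial segment of \<open>p\<close> up to time \<open>s\<close>, reparametrised by the unit interval.\<close>
    have h: "h0 (vertex (p s)) = k s + (h0 (vertex (p 0)) - k 0)" if s: "s \<in> {0..1}" for s
    proof -
      have sub: "continuous_on {0..1} (\<lambda>t. s * t)" "(\<lambda>t. s * t) ` {0..1} \<subseteq> {0..1}"
        using s by (auto intro!: continuous_on_mult_left continuous_on_id mult_le_one)
      have "continuous_map (top_of_set {0..1}) (top_of_set {0..1}) (\<lambda>t. s * t)"
        using sub by (simp add: image_subset_iff_funcset)
      from continuous_map_compose[OF this p[unfolded pathin_def]]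
      have "pathin M (p \<circ> (\<lambda>t. s * t))"
        unfolding pathin_def .
      from h0[OF singular_simplex_path_simplex[OF this], unfolded singular_face_path_simplex]
      have "?w (path_simplex (p \<circ> (\<lambda>t. s * t))) = h0 (vertex (p s)) - h0 (vertex (p 0))"
        by simp
      moreover have "continuous_on {0..1} (\<lambda>t. g (p (s * t)) + real_of_int (k (s * t)))"
        using continuous_on_compose2[OF k sub] .
      then have "continuous_on {0..1} (\<lambda>t. g (path_simplex (p \<circ> (\<lambda>t. s * t)) (edge_point t))
          + real_of_int ((k \<circ> (\<lambda>t. s * t)) t))"
        by (rule continuous_on_eq) (simp add: path_simplex_edge_point)
      from jump_eq[OF this]
      have "?w (path_simplex (p \<circ> (\<lambda>t. s * t))) = k s - k 0"
        by simp
      ultimately show ?thesis by simp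
    qed
    have "continuous_on {0..1}
        (\<lambda>t. (g (p t) + real_of_int (k t)) + real_of_int (h0 (vertex (p 0)) - k 0))"
      by (intro continuous_intros k)
    then show ?thesis
    proof (rule continuous_on_eq)
      fix t :: real assume "t \<in> {0..1}"
      from h[OF this] show "(g (p t) + real_of_int (k t)) + real_of_int (h0 (vertex (p 0)) - k 0)
          = g (p t) + real_of_int (h0 (vertex (p t)))"
        by linarith
    qed
  qed
  then show "\<exists>h :: 'a \<Rightarrow> int. \<forall>p. pathin M p \<longrightarrow>
      continuous_on {0..1} (\<lambda>t. g (p t) + real_of_int (h (p t)))"
    by (intro exI[of _ "h0 \<circ> vertex"]) simp
qed

text \<open>Lifting along the rays from the origin defines the correction.  For a path \<open>p\<close> the rays to its points
form a square, over which there is one continuous lift; its side on the origin is constant, so the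
correction at \<open>p(t)\<close> is that of the opposite side up to a constant.\<close>

lemma circle_lifting_Euclidean_space: "circle_lifting (Euclidean_space n)"
  unfolding circle_lifting_def
proof (intro allI impI)
  fix g :: "(nat \<Rightarrow> real) \<Rightarrow> real"
  assume g: "continuous_map (Euclidean_space n) euclidean (\<lambda>x. cis (2 * pi * g x))"
  define ray :: "(nat \<Rightarrow> real) \<Rightarrow> real \<Rightarrow> nat \<Rightarrow> real" where "ray x t = (\<lambda>i. t * x i)" for x t
  have "continuous_on {0..1} (\<lambda>t. g (p t) + real_of_int (jump (\<lambda>s. g (ray (p t) s))))"
    if p: "pathin (Euclidean_space n) p" for p
  proof -
    let ?Q = "{0..1} \<times> {0..1} :: (real \<times> real) set"
    have "continuous_on {0..1} (\<lambda>t. p t i)" for i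
    proof -
      have "continuous_map (top_of_set {0..1}) (powertop_real UNIV) p"
        using p by (auto simp: pathin_def Euclidean_space_def continuous_map_in_subtopology)
      then show ?thesis
        by (simp add: continuous_map_componentwise_UNIV)
    qed
    then have "continuous_on ?Q (\<lambda>z. p (snd z) i)" for i
      by (rule continuous_on_compose2) (auto intro!: continuous_intros)
    then have "continuous_on ?Q (\<lambda>z. ray (p (snd z)) (fst z) i)" for i
      unfolding ray_def by (intro continuous_intros)
    moreover have "p t i = 0" if "t \<in> {0..1}" "n \<le> i" for t i
      using path_image_subset_topspace[OF p] that by (auto simp: topspace_Euclidean_space)
    ultimately have "continuous_map (top_of_set ?Q) (Euclidean_space n) (\<lambda>z. ray (p (snd z)) (fst z))"
      by (auto simp: Euclidean_space_def continuous_map_in_subtopology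
          continuous_map_componentwise_UNIV ray_def)
    then obtain k where k: "continuous_on ?Q (\<lambda>z. g (ray (p (snd z)) (fst z)) + real_of_int (k z))"
      by (rule integer_shift_exists_along_map[OF g convex_Times[OF convex_real_interval(5,5)]])
    have on_square: "continuous_on {0..1} (\<lambda>s. g (ray (p (b s)) (a s)) + real_of_int (k (a s, b s)))"
      if "continuous_on {0..1} a" "continuous_on {0..1} b" "\<And>s. s \<in> {0..1} \<Longrightarrow> a s \<in> {0..1} \<and> b s \<in> {0..1}"
      for a b :: "real \<Rightarrow> real"
      using continuous_on_compose2[OF k continuous_on_Pair[OF that(1,2)]] that(3) by force
    have j: "jump (\<lambda>s. g (ray (p t) s)) = k (1, t) - k (0, 0)" if t: "t \<in> {0..1}" for t
    proof -
      have "continuous_on {0..1} (\<lambda>s. g (ray (p t) s) + real_of_int (k (s, t)))"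
        using on_square[of "\<lambda>s. s" "\<lambda>_. t"] t
        by (simp add: continuous_on_id)
      from jump_eq[OF this] have "jump (\<lambda>s. g (ray (p t) s)) = k (1, t) - k (0, t)" .
      moreover have "continuous_on {0..1} (\<lambda>t. g (ray (p t) 0) + real_of_int (k (0, t)))"
        using on_square[of "\<lambda>_. 0" "\<lambda>s. s"]
        by (simp add: continuous_on_id)
      then have "continuous_on {0..1} (\<lambda>t. g (\<lambda>i. 0) + real_of_int (k (0, t)))"
        by (simp add: ray_def)
      then have "k (0, t) - k (0, 0) = 0 - 0"
        by (intro integer_shift_difference_constant[of "{0..1}" "\<lambda>t. g (\<lambda>i. 0)"])
          (use t in \<open>auto intro!: continuous_intros\<close>)
      ultimately show ?thesis by simp
    qed
    have "continuous_on {0..1} (\<lambda>t. g (p t) + real_of_int (k (1, t)))"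
      using on_square[of "\<lambda>_. 1" "\<lambda>s. s"] by (simp add: continuous_on_id ray_def)
    from continuous_on_diff[OF this continuous_on_const]
    have "continuous_on {0..1} (\<lambda>t. (g (p t) + real_of_int (k (1, t))) - real_of_int (k (0, 0)))" .
    then show ?thesis
      by (rule continuous_on_eq) (simp add: j)
  qed
  then show "\<exists>h :: (nat \<Rightarrow> real) \<Rightarrow> int. \<forall>p. pathin (Euclidean_space n) p \<longrightarrow>
      continuous_on {0..1} (\<lambda>t. g (p t) + real_of_int (h (p t)))"
    by (intro exI[of _ "\<lambda>x. jump (\<lambda>s. g (ray x s))"]) simp
qed

section \<open>Separation of the complement by a connected set\<close>

text \<open>The frontier of \<open>P\<close> avoids both open sets, so the two functions agree on it.\<close>

lemma continuous_map_piecewise_disjoint_open: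
  assumes f: "continuous_map X Y f" and g: "continuous_map X Y g"
    and P: "openin X P" and Q: "openin X Q" and disj: "P \<inter> Q = {}"
    and agree: "\<And>x. x \<in> topspace X - P - Q \<Longrightarrow> f x = g x"
  shows "continuous_map X Y (\<lambda>x. if x \<in> P then f x else g x)"
proof (rule continuous_map_cases)
  fix x assume x: "x \<in> X frontier_of {x. x \<in> P}"
  have "x \<in> topspace X" "x \<notin> P"
    using x P frontier_of_subset_topspace[of X P] frontier_of_openin[OF P] by auto
  moreover have "x \<notin> Q"
    using x P Q disj openin_Int_closure_of_eq_empty[OF Q, of P] by (auto simp: frontier_of_def)
  ultimately show "f x = g x" using agree by blast
qed (auto intro: continuous_map_from_subtopology f g)

text \<open>With a Urysohn function \<open>l\<close> that is 0 on \<open>K\<close> and 1 off \<open>W\<close>, the angle \<open>g\<close> equal to \<open>l\<close> on \<open>P\<close> and 0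
elsewhere defines a continuous map to the circle: \<open>g\<close> is continuous on \<open>W\<close>, and \<open>g - 1\<^sub>P\<close> is
continuous on \<open>M - K\<close>.  If \<open>g + h\<close> is a lift, then \<open>h\<close> is constant along paths in \<open>W\<close>, whereas
\<open>h + 1\<^sub>P\<close> is constant along paths in \<open>U\<close>.  Both cannot hold for a point of \<open>U \<inter> P\<close> and a point
of \<open>U \<inter> Q\<close>.\<close>

theorem no_component_meets_both_sides:
  assumes lift: "circle_lifting M" and norm: "normal_space M"
    and K: "closedin M K" and W: "openin M W" "K \<subseteq> W" "path_connectedin M W"
    and P: "openin M P" and Q: "openin M Q" and disj: "P \<inter> Q = {}" and WK: "W - K = P \<union> Q"
    and U: "path_connectedin M U" "U \<inter> K = {}"
  shows "U \<inter> P = {} \<or> U \<inter> Q = {}"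
proof (rule ccontr)
  assume "\<not> ?thesis"
  then obtain p q where p: "p \<in> U" "p \<in> P" and q: "q \<in> U" "q \<in> Q" by blast
  have "disjnt K (topspace M - W)" using W by (auto simp: disjnt_def)
  then obtain l :: "'a \<Rightarrow> real" where l: "continuous_map M euclidean l"
    and l0: "\<And>x. x \<in> K \<Longrightarrow> l x = 0" and l1: "\<And>x. x \<in> topspace M - W \<Longrightarrow> l x = 1"
    using Urysohn_lemma_alt[OF norm K closedin_diff[OF closedin_topspace W(1)], of 0 1]
    by (metis image_subset_iff singletonD)
  define g where "g x = (if x \<in> P then l x else 0)" for x
  have "continuous_map M euclidean (\<lambda>x. cis (2 * pi * g x))"
  proof -
    have "continuous_map M euclidean ((\<lambda>r. cis (2 * pi * r)) \<circ> l)"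
      by (rule continuous_map_compose[OF l]) (simp add: continuous_intros)
    then have "continuous_map M euclidean (\<lambda>x. if x \<in> P then ((\<lambda>r. cis (2 * pi * r)) \<circ> l) x else 1)"
    proof (rule continuous_map_piecewise_disjoint_open[OF _ _ P Q disj])
      fix x assume "x \<in> topspace M - P - Q"
      then have "l x = 0 \<or> l x = 1" using WK l0 l1 by blast
      then show "((\<lambda>r. cis (2 * pi * r)) \<circ> l) x = 1" by auto
    qed simp
    then show ?thesis
      by (rule continuous_map_eq) (simp add: g_def)
  qed
  then obtain h :: "'a \<Rightarrow> int" where
    h: "\<And>\<gamma>. pathin M \<gamma> \<Longrightarrow> continuous_on {0..1} (\<lambda>t. g (\<gamma> t) + real_of_int (h (\<gamma> t)))"
    using lift unfolding circle_lifting_def by blast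
  have cont: "continuous_map (subtopology M S) euclidean (\<lambda>x. if x \<in> P then l x - c else 0)"
    if "\<And>x. x \<in> topspace M \<inter> S - P - Q \<Longrightarrow> l x = c" for S c
  proof -
    have "continuous_map (subtopology M S) euclidean (\<lambda>x. if x \<in> S \<inter> P then l x - c else 0)"
      using P Q disj that
      by (intro continuous_map_piecewise_disjoint_open[where Q = "S \<inter> Q"] continuous_map_from_subtopology
          continuous_map_diff[OF l] continuous_map_const[THEN iffD2] openin_subtopology_Int2) auto
    then show ?thesis
      by (rule continuous_map_eq) auto
  qed
  have path: "h (\<gamma> 1) - h (\<gamma> 0) = d (\<gamma> 1) - d (\<gamma> 0)"
    if \<gamma>: "pathin M \<gamma>" "\<gamma> \<in> {0..1} \<rightarrow> S"
      and "continuous_map (subtopology M S) euclidean (\<lambda>x. g x + real_of_int (d x))" for \<gamma> S d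
  proof -
    have "continuous_map (top_of_set {0..1}) (subtopology M S) \<gamma>"
      using \<gamma> by (auto simp: pathin_def continuous_map_in_subtopology)
    from continuous_map_compose[OF this that(3)]
    have "continuous_on {0..1} (\<lambda>t. g (\<gamma> t) + real_of_int (d (\<gamma> t)))"
      by (simp add: o_def)
    from integer_shift_difference_constant[OF _ h[OF \<gamma>(1)] this, of 1 0]
    show ?thesis by simp
  qed
  have "p \<in> W" "q \<in> W" using p q WK by auto
  then obtain \<gamma> where \<gamma>: "pathin M \<gamma>" "\<gamma> \<in> {0..1} \<rightarrow> W" "\<gamma> 0 = p" "\<gamma> 1 = q"
    using W(3) unfolding path_connectedin by meson
  have "continuous_map (subtopology M W) euclidean (\<lambda>x. g x + real_of_int 0)"
  proof -
    have "continuous_map (subtopology M W) euclidean (\<lambda>x. if x \<in> P then l x - 0 else 0)"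
      using WK l0 by (intro cont) auto
    then show ?thesis
      by (rule continuous_map_eq) (simp add: g_def)
  qed
  from path[OF \<gamma>(1,2) this] have 1: "h q = h p" using \<gamma> by simp
  obtain \<delta> where \<delta>: "pathin M \<delta>" "\<delta> \<in> {0..1} \<rightarrow> U" "\<delta> 0 = p" "\<delta> 1 = q"
    using U(1) p q unfolding path_connectedin by meson
  have "continuous_map (subtopology M U) euclidean (\<lambda>x. if x \<in> P then l x - 1 else 0)"
    using cont[of U 1] WK l1 U(2) by blast
  then have "continuous_map (subtopology M U) euclidean (\<lambda>x. g x + real_of_int (if x \<in> P then - 1 else 0))"
    by (rule continuous_map_eq) (simp add: g_def)
  from path[OF \<delta>(1,2) this] have "h q - h p = 1" using \<delta> p q disj by auto
  with 1 show False by simp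
qed

section \<open>Flows near an isolated invariant set\<close>

lemma closure_of_meets_open:
  "y \<in> M closure_of S \<Longrightarrow> openin M T \<Longrightarrow> y \<in> T \<Longrightarrow> \<exists>w\<in>S. w \<in> T"
  unfolding in_closure_of by blast

locale isolated_flow =
  fixes M :: "'a topology" and \<phi> :: "'a \<Rightarrow> real \<Rightarrow> 'a" and K N :: "'a set"
  assumes hausdorff: "Hausdorff_space M"
    and flow: "flow M \<phi>"
    and compact_K: "compactin M K"
    and isolating: "isolating_nbhd M \<phi> K N"
begin

lemma flow_continuous: "continuous_map (prod_topology M euclideanreal) M (\<lambda>(x, t). \<phi> x t)"
  using flow by (simp add: flow_def)

lemma flow_0 [simp]: "x \<in> topspace M \<Longrightarrow> \<phi> x 0 = x"
  and flow_add [simp]: "x \<in> topspace M \<Longrightarrow> \<phi> (\<phi> x s) t = \<phi> x (s + t)"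
  using flow by (auto simp: flow_def)

lemma flow_closed [simp]: "x \<in> topspace M \<Longrightarrow> \<phi> x t \<in> topspace M"
  using continuous_map_funspace[OF flow_continuous] by (auto simp: Pi_iff)

lemma time_map_continuous: "continuous_map M M (\<lambda>x. \<phi> x t)"
proof -
  have "continuous_map M (prod_topology M euclideanreal) (\<lambda>x. (x, t))"
    by (simp add: continuous_map_pairedI)
  from continuous_map_compose[OF this flow_continuous] show ?thesis
    by (simp add: o_def)
qed

lemma orbit_map_continuous:
  assumes "x \<in> topspace M"
  shows "continuous_map euclideanreal M (\<phi> x)"
proof -
  have "continuous_map euclideanreal (prod_topology M euclideanreal) (\<lambda>t. (x, t))"
    using assms by (simp add: continuous_map_pairedI)
  from continuous_map_compose[OF this flow_continuous] show ?thesis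
    by (simp add: o_def)
qed

lemma openin_time_preimage: "openin M A \<Longrightarrow> openin M {x \<in> topspace M. \<phi> x t \<in> A}"
  by (rule openin_continuous_map_preimage[OF time_map_continuous])

lemma open_orbit_preimage: "x \<in> topspace M \<Longrightarrow> openin M A \<Longrightarrow> open {t. \<phi> x t \<in> A}"
  using openin_continuous_map_preimage[OF orbit_map_continuous, of x A] by simp

lemma closed_orbit_preimage: "x \<in> topspace M \<Longrightarrow> closedin M A \<Longrightarrow> closed {t. \<phi> x t \<in> A}"
  using closedin_continuous_map_preimage[OF orbit_map_continuous, of x A] by simp

lemma compact_N: "compactin M N" and N_subset: "N \<subseteq> topspace M"
  and K_interior: "K \<subseteq> M interior_of N" and invariant_K: "invariant_set M \<phi> K"
  and maximal: "invariant_set M \<phi> S \<Longrightarrow> S \<subseteq> N \<Longrightarrow> S \<subseteq> K"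
  using isolating by (auto simp: isolating_nbhd_def nbhd_of_def)

lemma K_subset_N: "K \<subseteq> N"
  using K_interior interior_of_subset[of M N] by blast

lemma closed_N: "closedin M N" and closed_K: "closedin M K"
  using compactin_imp_closedin[OF hausdorff] compact_N compact_K by auto

lemma K_subset: "K \<subseteq> topspace M"
  using K_subset_N N_subset by blast

lemma flow_in_K: "x \<in> K \<Longrightarrow> \<phi> x t \<in> K"
  using invariant_K rangeI[of "\<phi> x" t] unfolding invariant_set_def orbit_def by blast

lemma flow_in_K_iff: "x \<in> topspace M \<Longrightarrow> \<phi> x t \<in> K \<longleftrightarrow> x \<in> K"
  using flow_in_K[of "\<phi> x t" "- t"] flow_in_K[of x t] by auto

lemma orbit_in_N_imp_K:
  assumes "x \<in> topspace M" "\<And>t. \<phi> x t \<in> N"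
  shows "x \<in> K"
proof -
  have "invariant_set M \<phi> (range (\<phi> x))"
    using assms(1) by (auto simp: invariant_set_def orbit_def)
  then have "range (\<phi> x) \<subseteq> K"
    using assms(2) by (intro maximal) auto
  moreover have "x \<in> range (\<phi> x)"
    using flow_0[OF assms(1)] by (metis rangeI)
  ultimately show ?thesis by blast
qed

lemma in_pos_part_iff: "x \<in> pos_part \<phi> N \<longleftrightarrow> x \<in> topspace M \<and> (\<forall>t\<ge>0. \<phi> x t \<in> N)"
proof -
  have "x \<in> N" if "x \<in> topspace M" "\<forall>t\<ge>0. \<phi> x t \<in> N"
    using that flow_0[of x] by (metis order_refl)
  then show ?thesis
    using N_subset by (auto simp: pos_part_def pos_orbit_def)
qed

lemma in_neg_part_iff: "x \<in> neg_part \<phi> N \<longleftrightarrow> x \<in> topspace M \<and> (\<forall>t\<le>0. \<phi> x t \<in> N)"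
proof -
  have "x \<in> N" if "x \<in> topspace M" "\<forall>t\<le>0. \<phi> x t \<in> N"
    using that flow_0[of x] by (metis order_refl)
  then show ?thesis
    using N_subset by (auto simp: neg_part_def neg_orbit_def)
qed

lemma pos_part_subset: "pos_part \<phi> N \<subseteq> N"
  by (auto simp: pos_part_def)

lemma pos_part_Int_neg_part: "pos_part \<phi> N \<inter> neg_part \<phi> N = K"
proof
  show "pos_part \<phi> N \<inter> neg_part \<phi> N \<subseteq> K"
  proof
    fix x assume "x \<in> pos_part \<phi> N \<inter> neg_part \<phi> N"
    then show "x \<in> K"
      by (intro orbit_in_N_imp_K) (metis Int_iff in_pos_part_iff in_neg_part_iff linear)+
  qed
  show "K \<subseteq> pos_part \<phi> N \<inter> neg_part \<phi> N"
    using flow_in_K subsetD[OF K_subset_N] subsetD[OF K_subset]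
    by (auto simp: in_pos_part_iff in_neg_part_iff)
qed

lemma flow_in_pos_part: "x \<in> pos_part \<phi> N \<Longrightarrow> 0 \<le> t \<Longrightarrow> \<phi> x t \<in> pos_part \<phi> N"
  by (auto simp: in_pos_part_iff)

lemma closed_pos_part: "closedin M (pos_part \<phi> N)"
proof -
  have "pos_part \<phi> N = (\<Inter>t\<in>{0..}. {x \<in> topspace M. \<phi> x t \<in> N})"
    by (auto simp: in_pos_part_iff)
  also have "closedin M \<dots>"
    by (intro closedin_INT closedin_continuous_map_preimage[OF time_map_continuous] closed_N) auto
  finally show ?thesis .
qed

text \<open>Time reversal exchanges \<open>N\<^sup>+\<close> with \<open>N\<^sup>-\<close> and attraction with repulsion, so that facts about
forward orbits carry over to backward orbits.\<close>

lemma isolated_flow_reversed: "isolated_flow M (reversed_flow \<phi>) K N"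
proof -
  have inv: "invariant_set M (reversed_flow \<phi>) S \<longleftrightarrow> invariant_set M \<phi> S" for S
  proof -
    have "range (\<lambda>t. \<phi> x (- t)) = range (\<phi> x)" for x
      by (auto simp: image_iff) (metis minus_minus)
    then show ?thesis by (simp add: invariant_set_def orbit_def reversed_flow_def[abs_def])
  qed
  have "continuous_map (prod_topology M euclideanreal) (prod_topology M euclideanreal)
      (\<lambda>(x, t). (x, - t))"
    by (simp add: case_prod_unfold continuous_map_pairedI continuous_map_fst continuous_map_snd
        continuous_map_minus)
  from continuous_map_compose[OF this flow_continuous]
  have "flow M (reversed_flow \<phi>)"
    by (auto simp: flow_def reversed_flow_def o_def case_prod_unfold)
  then show ?thesis
    using hausdorff compact_K isolating
    by (simp add: isolated_flow_def isolating_nbhd_def inv)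
qed

lemma pos_part_reversed: "pos_part (reversed_flow \<phi>) N = neg_part \<phi> N"
proof -
  interpret rev: isolated_flow M "reversed_flow \<phi>" K N by (rule isolated_flow_reversed)
  have "(\<forall>t\<ge>0. \<phi> x (- t) \<in> N) \<longleftrightarrow> (\<forall>t\<le>0. \<phi> x t \<in> N)" for x
    by (metis minus_minus neg_0_le_iff_le)
  then show ?thesis
    by (auto simp: in_neg_part_iff rev.in_pos_part_iff reversed_flow_def)
qed

lemma closed_neg_part: "closedin M (neg_part \<phi> N)"
  using isolated_flow.closed_pos_part[OF isolated_flow_reversed] by (simp add: pos_part_reversed)

text \<open>A point that is in \<open>N\<^sup>+\<close> at time \<open>s\<close> stays in \<open>N\<close> at all times after \<open>s\<close>.  If such points with
arbitrarily negative \<open>s\<close> accumulate at \<open>x\<close>, then every point of the orbit of \<open>x\<close> is a limit of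
points of the closed set \<open>N\<close>.\<close>

lemma in_K_if_early_entries_accumulate:
  assumes x: "x \<in> topspace M"
    and early: "\<And>B T. openin M B \<Longrightarrow> x \<in> B \<Longrightarrow> \<exists>u\<in>B. \<exists>s\<le>T. \<phi> u s \<in> pos_part \<phi> N"
  shows "x \<in> K"
proof (rule orbit_in_N_imp_K[OF x], rule ccontr)
  fix t assume "\<phi> x t \<notin> N"
  let ?B = "{u \<in> topspace M. \<phi> u t \<in> topspace M - N}"
  have "openin M ?B"
    using closed_N by (intro openin_time_preimage) auto
  then obtain u s where u: "u \<in> ?B" "s \<le> t" "\<phi> u s \<in> pos_part \<phi> N"
    using early[of ?B t] x \<open>\<phi> x t \<notin> N\<close> by auto
  then have "\<phi> (\<phi> u s) (t - s) \<in> N"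
    unfolding in_pos_part_iff by (metis diff_ge_0_iff_ge)
  then show False using u by simp
qed

text \<open>The limit set of a forward orbit that stays in the compact set \<open>N\<close> is nonempty and invariant, and it lies
in \<open>N\<close>; maximality of \<open>K\<close> among such invariant sets places it inside \<open>K\<close>.\<close>

lemma pos_part_subset_attraction_region: "pos_part \<phi> N \<subseteq> attraction_region M \<phi> K"
proof
  fix x assume xp: "x \<in> pos_part \<phi> N"
  then have x: "x \<in> topspace M" and fwd: "\<And>t. 0 \<le> t \<Longrightarrow> \<phi> x t \<in> N"
    by (auto simp: in_pos_part_iff)
  let ?T = "\<lambda>t. M closure_of (\<phi> x ` {t..})"
  have TN: "?T t \<subseteq> N" if "0 \<le> t" for t
    using that fwd by (intro closure_of_minimal[OF _ closed_N]) auto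
  have mono: "?T s \<subseteq> ?T t" if "t \<le> s" for s t
    using that by (intro closure_of_mono image_mono) auto
  have "(\<Inter>n. ?T (real n)) \<noteq> {}"
  proof (rule compact_space_imp_nest)
    show "compact_space (subtopology M N)"
      using compact_N by (simp add: compactin_subspace)
    show "closedin (subtopology M N) (?T (real n))" for n
      using TN[of "real n"] by (simp add: closedin_closed_subtopology[OF closed_N])
    show "?T (real n) \<noteq> {}" for n
      using x by (subst closure_of_eq_empty) auto
    show "decseq (\<lambda>n. ?T (real n))"
      unfolding decseq_def by (intro allI impI mono) simp
  qed
  then obtain y where y: "\<And>n. y \<in> ?T (real n)" by blast
  have "y \<in> ?T t" for t
    using y[of "nat \<lceil>t\<rceil>"] mono[of t "real (nat \<lceil>t\<rceil>)"] real_nat_ceiling_ge[of t] by blast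
  then have ne: "omega_limit M \<phi> x \<noteq> {}"
    unfolding omega_limit_def by blast
  have \<omega>N: "omega_limit M \<phi> x \<subseteq> N"
    using TN[of 1] by (auto simp: omega_limit_def)
  have "omega_limit M \<phi> x \<subseteq> K"
  proof (rule maximal[OF _ \<omega>N])
    have "\<phi> y s \<in> ?T t" if "y \<in> omega_limit M \<phi> x" for y s t
    proof -
      have "y \<in> ?T (max 1 (t - s))"
        using that by (auto simp: omega_limit_def)
      then have "\<phi> y s \<in> (\<lambda>x. \<phi> x s) ` ?T (max 1 (t - s))" by blast
      also have "\<dots> \<subseteq> M closure_of ((\<lambda>x. \<phi> x s) ` \<phi> x ` {max 1 (t - s)..})"
        by (rule continuous_map_image_closure_subset[OF time_map_continuous])
      also have "\<dots> \<subseteq> ?T t"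
        using x by (intro closure_of_mono) (auto simp: image_iff)
      finally show ?thesis .
    qed
    moreover have "omega_limit M \<phi> x \<subseteq> topspace M"
      using \<omega>N N_subset by blast
    ultimately show "invariant_set M \<phi> (omega_limit M \<phi> x)"
      by (auto simp: invariant_set_def orbit_def omega_limit_def[of M \<phi> x])
  qed
  with ne x show "x \<in> attraction_region M \<phi> K"
    by (simp add: attraction_region_def)
qed

lemma attracted_point_enters:
  assumes "x \<in> attraction_region M \<phi> K" "openin M W" "K \<subseteq> W"
  shows "\<exists>t\<ge>T. \<phi> x t \<in> W"
proof -
  obtain y where "y \<in> omega_limit M \<phi> x" "y \<in> K"
    using assms(1) by (auto simp: attraction_region_def)
  then have "y \<in> M closure_of (\<phi> x ` {max T 1..})" "y \<in> W"
    using assms(3) by (auto simp: omega_limit_def)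
  then show ?thesis
    using closure_of_meets_open[OF _ assms(2)] by fastforce
qed

end

section \<open>Time reversal and prolongations\<close>

lemma limit_regions_reversed:
  "attraction_region M (reversed_flow \<phi>) K = repulsion_region M \<phi> K"
  "repulsion_region M (reversed_flow \<phi>) K = attraction_region M \<phi> K"
  "pos_prolongation M (reversed_flow \<phi>) x = neg_prolongation M \<phi> x"
  "neg_prolongation M (reversed_flow \<phi>) x = pos_prolongation M \<phi> x"
proof -
  have im: "reversed_flow \<phi> u ` {t..} = \<phi> u ` {..- t}" "reversed_flow \<phi> u ` {..t} = \<phi> u ` {- t..}" for u t
  proof -
    have "reversed_flow \<phi> u ` S = \<phi> u ` uminus ` S" for S
      by (auto simp: reversed_flow_def image_image)
    then show "reversed_flow \<phi> u ` {t..} = \<phi> u ` {..- t}" "reversed_flow \<phi> u ` {..t} = \<phi> u ` {- t..}"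
      by simp_all
  qed
  have ap: "(\<Inter>t\<in>{0<..}. F (- t)) = (\<Inter>t\<in>{..<0}. F t)" for F :: "real \<Rightarrow> 'b set"
  proof -
    have "{..<0::real} = uminus ` {0<..}" by simp
    then show ?thesis by (metis INF_image image_cong o_def)
  qed
  have an: "(\<Inter>t\<in>{..<0}. F (- t)) = (\<Inter>t\<in>{0<..}. F t)" for F :: "real \<Rightarrow> 'b set"
    using ap[of "\<lambda>t. F (- t)"] by simp
  have om: "omega_limit M (reversed_flow \<phi>) x = neg_omega_limit M \<phi> x"
    "neg_omega_limit M (reversed_flow \<phi>) x = omega_limit M \<phi> x" for x
    unfolding omega_limit_def neg_omega_limit_def im by (rule ap, rule an)
  show "attraction_region M (reversed_flow \<phi>) K = repulsion_region M \<phi> K"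
    "repulsion_region M (reversed_flow \<phi>) K = attraction_region M \<phi> K"
    by (simp_all add: attraction_region_def repulsion_region_def om)
  show "pos_prolongation M (reversed_flow \<phi>) x = neg_prolongation M \<phi> x"
    "neg_prolongation M (reversed_flow \<phi>) x = pos_prolongation M \<phi> x"
    unfolding pos_prolongation_def neg_prolongation_def im
    by (intro INF_cong refl ap, intro INF_cong refl an)
qed

lemma joint_prolongation_reversed:
  "(z, y) \<in> joint_prolongation M (reversed_flow \<phi>) x \<longleftrightarrow> (y, z) \<in> joint_prolongation M \<phi> x"
proof -
  have imp: "(z, y) \<in> joint_prolongation M (reversed_flow \<psi>) x" if J: "(y, z) \<in> joint_prolongation M \<psi> x"
    for y z and \<psi>
  proof -
    obtain X t s where X: "range X \<subseteq> topspace M" "limitin M X x sequentially"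
      and t: "filterlim t at_top sequentially" and s: "filterlim s at_bot sequentially"
      and y: "limitin M (\<lambda>n::nat. \<psi> (X n) (t n)) y sequentially"
      and z: "limitin M (\<lambda>n. \<psi> (X n) (s n)) z sequentially"
      using J unfolding joint_prolongation_def mem_Collect_eq case_prod_conv
      by (elim exE conjE) (rule that)
    have "filterlim (\<lambda>n. - s n) at_top sequentially" "filterlim (\<lambda>n. - t n) at_bot sequentially"
      using s t by (simp_all add: filterlim_uminus_at_bot[of s] filterlim_uminus_at_top[of t])
    then show ?thesis
      using X y z unfolding joint_prolongation_def reversed_flow_def mem_Collect_eq case_prod_conv
      by (intro exI[of _ X] exI[of _ "\<lambda>n. - s n"] exI[of _ "\<lambda>n. - t n"]) simp
  qed
  have "reversed_flow (reversed_flow \<phi>) = \<phi>"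
    by (simp add: reversed_flow_def fun_eq_iff)
  then show ?thesis using imp[of y z \<phi>] imp[of z y "reversed_flow \<phi>"] by auto
qed

lemma dissonant_point_reversed:
  "dissonant_point M (reversed_flow \<phi>) K x \<longleftrightarrow> dissonant_point M \<phi> K x"
proof -
  have "joint_prolongation M (reversed_flow \<phi>) x \<inter> (K \<times> K) \<noteq> {} \<longleftrightarrow>
      joint_prolongation M \<phi> x \<inter> (K \<times> K) \<noteq> {}"
    using joint_prolongation_reversed[of _ _ M \<phi> x] by blast
  then show ?thesis
    by (auto simp: dissonant_point_def positively_dissonant_def negatively_dissonant_def
        externally_dissonant_def influence_region_def limit_regions_reversed)
qed

lemma neg_omega_limit_subset_neg_prolongation:
  assumes "x \<in> topspace M"
  shows "neg_omega_limit M \<phi> x \<subseteq> neg_prolongation M \<phi> x"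
proof -
  have "M closure_of (\<phi> x ` {..t}) \<subseteq> M closure_of (\<Union>u\<in>U. \<phi> u ` {..t})"
    if "nbhd_of M {x} U" for U t
    using that interior_of_subset[of M U] by (intro closure_of_mono) (auto simp: nbhd_of_def)
  then show ?thesis
    unfolding neg_omega_limit_def neg_prolongation_def by blast
qed

text \<open>The sequence that converges to \<open>z\<close> is eventually inside each of the sets whose closures define the
negative prolongation.\<close>

lemma joint_prolongation_imp_neg_prolongation:
  assumes "(y, z) \<in> joint_prolongation M \<phi> x"
  shows "z \<in> neg_prolongation M \<phi> x"
proof -
  obtain X s where X: "limitin M X x sequentially" and s: "filterlim s at_bot sequentially"
    and z: "limitin M (\<lambda>n::nat. \<phi> (X n) (s n)) z sequentially"
    using assms by (auto simp: joint_prolongation_def)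
  have "z \<in> M closure_of (\<Union>u\<in>U. \<phi> u ` {..t})" if U: "nbhd_of M {x} U" for U t
    unfolding in_closure_of
  proof (intro conjI allI impI)
    show "z \<in> topspace M" using z by (simp add: limitin_def)
    fix T assume T: "z \<in> T \<and> openin M T"
    have "\<forall>\<^sub>F n in sequentially. X n \<in> M interior_of U"
      using X U by (auto simp: limitin_def nbhd_of_def)
    moreover have "\<forall>\<^sub>F n in sequentially. s n \<le> t"
      using s by (simp add: filterlim_at_bot)
    moreover have "\<forall>\<^sub>F n in sequentially. \<phi> (X n) (s n) \<in> T"
      using z T by (auto simp: limitin_def)
    ultimately have "\<forall>\<^sub>F n in sequentially. X n \<in> M interior_of U \<and> s n \<le> t \<and> \<phi> (X n) (s n) \<in> T"
      by eventually_elim auto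
    then obtain n where "X n \<in> M interior_of U" "s n \<le> t" "\<phi> (X n) (s n) \<in> T"
      using eventually_happens'[OF sequentially_bot] by blast
    then show "\<exists>w. w \<in> (\<Union>u\<in>U. \<phi> u ` {..t}) \<and> w \<in> T"
      using interior_of_subset[of M U] by blast
  qed
  then show ?thesis by (auto simp: neg_prolongation_def)
qed

section \<open>Components attracted near the invariant set\<close>

text \<open>\<open>U\<close> is meant to be a component of \<open>M - K\<close> on which the flow is locally attracted by \<open>K\<close>, with \<open>W\<close> the
neighbourhood of \<open>K\<close> that witnesses it.  Repelled components are instances for the reversed flow.\<close>

locale attracted_side = isolated_flow +
  fixes U W
  assumes open_U: "openin M U" and U_K: "U \<inter> K = {}"
    and U_invariant: "\<And>x t. x \<in> U \<Longrightarrow> \<phi> x t \<in> U"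
    and open_W: "openin M W" and K_W: "K \<subseteq> W" and U_W: "U \<inter> W \<subseteq> pos_part \<phi> N"
begin

lemma U_topspace: "x \<in> U \<Longrightarrow> x \<in> topspace M"
  using open_U openin_subset by blast

text \<open>This is the obstruction to dissonance: a point of \<open>K\<close> in the prolongation would provide points near
\<open>x\<close> that are in \<open>U \<inter> W \<subseteq> N\<^sup>+\<close> at arbitrarily early times.\<close>

lemma neg_prolongation_misses_K:
  assumes "x \<in> U"
  shows "neg_prolongation M \<phi> x \<inter> K = {}"
proof (rule ccontr)
  assume "neg_prolongation M \<phi> x \<inter> K \<noteq> {}"
  then obtain y where y: "y \<in> neg_prolongation M \<phi> x" "y \<in> K" by blast
  have "x \<in> K"
  proof (rule in_K_if_early_entries_accumulate[OF U_topspace[OF assms]])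
    fix B T assume B: "openin M B" "x \<in> B"
    then have BU: "openin M (B \<inter> U)" by (simp add: open_U openin_Int)
    then have "nbhd_of M {x} (B \<inter> U)"
      using B assms openin_subset[OF BU] by (simp add: nbhd_of_def interior_of_openin)
    then have "y \<in> M closure_of (\<Union>u\<in>(B \<inter> U). \<phi> u ` {..min T (- 1)})"
      using y(1) by (auto simp: neg_prolongation_def)
    moreover have "y \<in> W" using y K_W by blast
    ultimately obtain u s where "u \<in> B \<inter> U" "s \<le> min T (- 1)" "\<phi> u s \<in> W"
      using closure_of_meets_open[OF _ open_W] by blast
    then show "\<exists>u\<in>B. \<exists>s\<le>T. \<phi> u s \<in> pos_part \<phi> N"
      using U_W U_invariant by (intro bexI[of _ u] exI[of _ s]) auto
  qed
  then show False using assms U_K by blast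
qed

lemma not_repelled: "x \<in> U \<Longrightarrow> x \<notin> repulsion_region M \<phi> K"
  using neg_prolongation_misses_K[of x] neg_omega_limit_subset_neg_prolongation[OF U_topspace, of x \<phi>]
  by (auto simp: repulsion_region_def)

text \<open>Negative and external dissonance would put a point of \<open>K\<close> into the negative prolongation.  A
positively dissonant point is repelled by \<open>K\<close>, which is impossible for the same reason.\<close>

lemma not_dissonant: "x \<in> U \<Longrightarrow> \<not> dissonant_point M \<phi> K x"
  using neg_prolongation_misses_K[of x] not_repelled[of x]
    joint_prolongation_imp_neg_prolongation[of _ _ M \<phi> x]
  by (auto simp: dissonant_point_def positively_dissonant_def negatively_dissonant_def
      externally_dissonant_def influence_region_def)

text \<open>A backward orbit in a compact set has a limit point \<open>y\<close>.  As \<open>y\<close> is attracted or repelled by \<open>K\<close>, it is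
in \<open>W\<close> at some time \<open>r\<close>, and so is every point close to \<open>y\<close>.  The orbit of \<open>x\<close> is therefore in
\<open>W\<close> at arbitrarily early times, which forces \<open>x \<in> K\<close>.\<close>

lemma backward_orbit_not_in_compact:
  assumes I: "influence_region M \<phi> K = topspace M" and x: "x \<in> U" and C: "compactin M C"
  shows "\<not> \<phi> x ` {..0} \<subseteq> C"
proof
  assume sub: "\<phi> x ` {..0} \<subseteq> C"
  note xt = U_topspace[OF x]
  let ?T = "\<lambda>n. M closure_of (\<phi> x ` {..- real n})"
  have cl: "closedin M C" by (rule compactin_imp_closedin[OF hausdorff C])
  have "(\<Inter>n. ?T n) \<noteq> {}"
  proof (rule compact_space_imp_nest)
    show "compact_space (subtopology M C)"
      using C by (simp add: compactin_subspace)
    show "closedin (subtopology M C) (?T n)" for n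
      using sub closure_of_minimal[OF _ cl, of "\<phi> x ` {..- real n}"]
      by (force simp: closedin_closed_subtopology[OF cl])
    show "?T n \<noteq> {}" for n
      using xt by (subst closure_of_eq_empty) auto
    show "decseq ?T"
      unfolding decseq_def by (intro allI impI closure_of_mono image_mono) auto
  qed
  then obtain y where y: "\<And>n. y \<in> ?T n" by blast
  then have yt: "y \<in> topspace M" using in_closure_of by fast
  interpret rev: isolated_flow M "reversed_flow \<phi>" K N by (rule isolated_flow_reversed)
  have "y \<in> attraction_region M \<phi> K \<or> y \<in> repulsion_region M \<phi> K"
    using I yt by (auto simp: influence_region_def)
  then obtain r where r: "\<phi> y r \<in> W"
    using attracted_point_enters[OF _ open_W K_W, of y 0] rev.attracted_point_enters[OF _ open_W K_W, of y 0]
    unfolding limit_regions_reversed reversed_flow_def by blast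
  have "x \<in> K"
  proof (rule in_K_if_early_entries_accumulate[OF xt])
    fix B T assume B: "openin M B" "x \<in> B"
    \<comment> \<open>Large enough for \<open>- n + r \<le> T\<close>.\<close>
    let ?n = "nat \<lceil>r - T\<rceil>"
    obtain s where s: "s \<le> - real ?n" "\<phi> (\<phi> x s) r \<in> W"
      using closure_of_meets_open[OF y[of ?n] openin_time_preimage[OF open_W, of r]] yt r by auto
    then have "\<phi> x (s + r) \<in> W" "s + r \<le> T"
      using xt real_nat_ceiling_ge[of "r - T"] by auto
    then show "\<exists>u\<in>B. \<exists>s\<le>T. \<phi> u s \<in> pos_part \<phi> N"
      using U_W U_invariant[OF x] B by blast
  qed
  then show False using x U_K by blast
qed

end

lemma (in isolated_flow) K_not_dissonant:
  assumes "x \<in> K"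
  shows "\<not> dissonant_point M \<phi> K x"
proof -
  interpret rev: isolated_flow M "reversed_flow \<phi>" K N by (rule isolated_flow_reversed)
  have "x \<in> attraction_region M \<phi> K" "x \<in> repulsion_region M \<phi> K"
    using assms pos_part_subset_attraction_region rev.pos_part_subset_attraction_region
      pos_part_Int_neg_part by (auto simp: limit_regions_reversed pos_part_reversed)
  then show ?thesis
    by (auto simp: dissonant_point_def positively_dissonant_def negatively_dissonant_def
      externally_dissonant_def influence_region_def)
qed

section \<open>One-sidedness of the complementary components\<close>

lemma path_connected_open_neighbourhood:
  assumes lpc: "locally_path_connected_space M" and K: "connectedin M K" "K \<noteq> {}"
    and A: "openin M A" "K \<subseteq> A"
  obtains W where "openin M W" "K \<subseteq> W" "W \<subseteq> A" "path_connectedin M W"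
proof -
  obtain k where k: "k \<in> K" using K by blast
  have lpcA: "locally_path_connected_space (subtopology M A)"
    using locally_path_connected_space_open_subset lpc A(1) by blast
  let ?W = "path_component_of_set (subtopology M A) k"
  have WA: "?W \<subseteq> A" using path_component_of_subset_topspace[of "subtopology M A" k] by auto
  have "openin (subtopology M A) ?W"
    by (rule openin_path_component_of_locally_path_connected_space[OF lpcA])
  then have "openin M ?W" using A(1) openin_open_subtopology by blast
  moreover have "connectedin (subtopology M A) K"
    using K A by (simp add: connectedin_subtopology)
  then have "K \<subseteq> ?W"
    unfolding path_component_eq_connected_component_of[OF lpcA]
    using k by (rule connected_component_of_maximal)
  moreover have "path_connectedin M ?W"
    using path_connectedin_path_component_of[of "subtopology M A" k]
    by (simp add: path_connectedin_subtopology)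
  ultimately show thesis using that WA by blast
qed

lemma nonsaddle_reversed:
  "nonsaddle_set M (reversed_flow \<phi>) K \<longleftrightarrow> nonsaddle_set M \<phi> K"
proof -
  have "reversed_flow \<phi> x ` S = \<phi> x ` uminus ` S" for x S
    by (auto simp: reversed_flow_def image_image)
  then have "pos_orbit (reversed_flow \<phi>) x = neg_orbit \<phi> x"
    "neg_orbit (reversed_flow \<phi>) x = pos_orbit \<phi> x" "orbit (reversed_flow \<phi>) x = orbit \<phi> x" for x
    by (simp_all add: pos_orbit_def neg_orbit_def orbit_def)
  then show ?thesis
    by (simp add: nonsaddle_set_def saddle_set_def invariant_set_def conj_commute)
qed

lemma nonsaddle_neighbourhood:
  assumes "nonsaddle_set M \<phi> K" "nbhd_of M K A"
  obtains V where "openin M V" "K \<subseteq> V"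
    "\<And>x. x \<in> V \<Longrightarrow> pos_orbit \<phi> x \<subseteq> A \<or> neg_orbit \<phi> x \<subseteq> A"
proof -
  obtain V where V: "nbhd_of M K V" "\<forall>x\<in>V. pos_orbit \<phi> x \<subseteq> A \<or> neg_orbit \<phi> x \<subseteq> A"
    using assms unfolding nonsaddle_set_def saddle_set_def by blast
  show thesis
    using V interior_of_subset[of M V]
    by (intro that[of "M interior_of V"]) (auto simp: nbhd_of_def)
qed

lemma nbhd_of_open: "openin M W \<Longrightarrow> K \<subseteq> W \<Longrightarrow> nbhd_of M K W"
  using openin_subset[of M W] by (simp add: nbhd_of_def interior_of_openin)

lemma (in attracted_side) locally_attracted: "locally_attracted M \<phi> K U"
  using nbhd_of_open[OF open_W K_W] U_W pos_part_subset_attraction_region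
  unfolding locally_attracted_def by blast

text \<open>If \<open>U\<close> is the whole complement of \<open>K\<close>, then all of \<open>W\<close> lies in \<open>N\<^sup>+\<close>.  For a neighbourhood \<open>B\<close> of
\<open>K\<close>, the non-saddle condition keeps one half of each orbit starting near \<open>K\<close> inside \<open>B \<inter> N\<close>;
outside \<open>K\<close> this cannot be the backward half, since \<open>N\<^sup>+ \<inter> N\<^sup>- = K\<close>.\<close>

lemma (in attracted_side) stable_global_attractor:
  assumes U: "U = topspace M - K" and I: "influence_region M \<phi> K = topspace M"
    and ns: "nonsaddle_set M \<phi> K"
  shows "stable_global_attractor M \<phi> K"
proof -
  have "K \<subseteq> attraction_region M \<phi> K"
    using pos_part_Int_neg_part pos_part_subset_attraction_region by blast
  moreover have "U \<subseteq> attraction_region M \<phi> K"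
    using not_repelled I U by (auto simp: influence_region_def)
  ultimately have A: "attraction_region M \<phi> K = topspace M"
    using U by (auto simp: attraction_region_def)
  have "stable_set M \<phi> K"
    unfolding stable_set_def
  proof (intro allI impI)
    fix B assume B: "nbhd_of M K B"
    have "nbhd_of M K (B \<inter> N)"
      using B K_interior by (auto simp: nbhd_of_def interior_of_Int)
    then obtain V where V: "openin M V" "K \<subseteq> V"
      "\<And>x. x \<in> V \<Longrightarrow> pos_orbit \<phi> x \<subseteq> B \<inter> N \<or> neg_orbit \<phi> x \<subseteq> B \<inter> N"
      using nonsaddle_neighbourhood[OF ns] by blast
    have "pos_orbit \<phi> x \<subseteq> B" if x: "x \<in> V \<inter> W" for x
    proof (rule ccontr)
      assume n: "\<not> pos_orbit \<phi> x \<subseteq> B"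
      then have neg: "neg_orbit \<phi> x \<subseteq> N" using V(3)[of x] x by blast
      have xt: "x \<in> topspace M" using x openin_subset[OF V(1)] by blast
      have "K \<subseteq> B" using B interior_of_subset[of M B] by (auto simp: nbhd_of_def)
      then have "x \<notin> K" using n flow_in_K by (auto simp: pos_orbit_def)
      then have "x \<in> pos_part \<phi> N" using x U xt U_W by blast
      moreover have "x \<in> neg_part \<phi> N"
        using neg xt by (auto simp: in_neg_part_iff neg_orbit_def)
      ultimately show False using \<open>x \<notin> K\<close> pos_part_Int_neg_part by blast
    qed
    moreover have "nbhd_of M K (V \<inter> W)"
      using V open_W K_W by (intro nbhd_of_open openin_Int) auto
    ultimately show "\<exists>V. nbhd_of M K V \<and> (\<forall>x\<in>V. pos_orbit \<phi> x \<subseteq> B)" by blast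
  qed
  moreover have "nbhd_of M K (topspace M)"
    using K_subset by (intro nbhd_of_open) auto
  ultimately show ?thesis
    using A compact_K invariant_K by (simp add: stable_global_attractor_def asymptotically_stable_def)
qed

context isolated_flow
begin

lemma complement_component:
  assumes lpc: "locally_path_connected_space M" and U: "U \<in> components_in M (topspace M - K)"
  shows "openin M U" "path_connectedin M U" "U \<inter> K = {}" "\<And>x t. x \<in> U \<Longrightarrow> \<phi> x t \<in> U" "U \<noteq> {}"
proof -
  let ?X = "subtopology M (topspace M - K)"
  have o: "openin M (topspace M - K)" using closed_K by auto
  have lpcX: "locally_path_connected_space ?X"
    using locally_path_connected_space_open_subset lpc o by blast
  have Uc: "U \<in> connected_components_of ?X" using U by (simp add: components_in_def)
  then have Up: "U \<in> path_components_of ?X"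
    by (simp add: path_components_eq_connected_components_of[OF lpcX])
  have "openin ?X U"
    using openin_path_components_of_locally_path_connected_space[OF lpcX Up] .
  then show "openin M U" using o openin_open_subtopology by blast
  show "path_connectedin M U"
    using path_connectedin_path_components_of[OF Up] by (simp add: path_connectedin_subtopology)
  have sub: "U \<subseteq> topspace M - K" using connected_components_of_subset[OF Uc] by auto
  then show "U \<inter> K = {}" by blast
  show "U \<noteq> {}" by (rule nonempty_connected_components_of[OF Uc])
  fix x t assume x: "x \<in> U"
  then have xt: "x \<in> topspace M" "x \<notin> K" using sub by auto
  have "connectedin M (range (\<phi> x))"
    using connectedin_continuous_map_image[OF orbit_map_continuous[OF xt(1)], of UNIV] by simp
  then have "connectedin ?X (range (\<phi> x))"
    using xt flow_in_K_iff by (auto simp: connectedin_subtopology)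
  moreover have "x \<in> range (\<phi> x)" using flow_0[OF xt(1)] by (metis rangeI)
  ultimately have "range (\<phi> x) \<subseteq> U"
    using connected_components_of_maximal[OF Uc] x by (auto simp: disjnt_def)
  then show "\<phi> x t \<in> U" by blast
qed

text \<open>\<open>W - N\<^sup>-\<close> and \<open>W - N\<^sup>+\<close> are open and disjoint and cover \<open>W - K\<close>, so a component of the complement meets
at most one of them.\<close>

theorem complement_component_one_sided:
  assumes lift: "circle_lifting M" and norm: "normal_space M" and lpc: "locally_path_connected_space M"
    and W: "openin M W" "K \<subseteq> W" "path_connectedin M W" "W \<subseteq> pos_part \<phi> N \<union> neg_part \<phi> N"
    and U: "U \<in> components_in M (topspace M - K)"
  shows "attracted_side M \<phi> K N U W \<or> attracted_side M (reversed_flow \<phi>) K N U W"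
proof -
  note U' = complement_component[OF lpc U]
  have "U \<inter> (W - neg_part \<phi> N) = {} \<or> U \<inter> (W - pos_part \<phi> N) = {}"
    using W(4) pos_part_Int_neg_part closed_pos_part closed_neg_part U'(2,3)
    by (intro no_component_meets_both_sides[OF lift norm closed_K W(1-3)] openin_diff W(1)) auto
  then have "U \<inter> W \<subseteq> pos_part \<phi> N \<or> U \<inter> W \<subseteq> pos_part (reversed_flow \<phi>) N"
    using W(4) by (auto simp: pos_part_reversed)
  then show ?thesis
    using isolated_flow_axioms isolated_flow_reversed U' W
    by (auto simp: attracted_side_def attracted_side_axioms_def reversed_flow_def[of \<phi>])
qed

lemma one_sided_neighbourhood:
  assumes lpc: "locally_path_connected_space M" and K: "connectedin M K" "K \<noteq> {}"
    and ns: "nonsaddle_set M \<phi> K"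
  obtains W where "openin M W" "K \<subseteq> W" "path_connectedin M W" "W \<subseteq> pos_part \<phi> N \<union> neg_part \<phi> N"
proof -
  have "nbhd_of M K N" using K_interior N_subset by (simp add: nbhd_of_def)
  then obtain V where V: "openin M V" "K \<subseteq> V"
      "\<And>x. x \<in> V \<Longrightarrow> pos_orbit \<phi> x \<subseteq> N \<or> neg_orbit \<phi> x \<subseteq> N"
    using nonsaddle_neighbourhood[OF ns] by blast
  obtain W where W: "openin M W" "K \<subseteq> W" "W \<subseteq> V" "path_connectedin M W"
    using path_connected_open_neighbourhood[OF lpc K V(1,2)] .
  have "W \<subseteq> pos_part \<phi> N \<union> neg_part \<phi> N"
    using V(3) W(3) openin_subset[OF V(1)]
    by (force simp: in_pos_part_iff in_neg_part_iff pos_orbit_def neg_orbit_def image_subset_iff)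
  then show thesis using that W by blast
qed

theorem no_dissonance_and_local_attraction_or_repulsion:
  assumes lift: "circle_lifting M" and norm: "normal_space M" and lpc: "locally_path_connected_space M"
    and K: "connectedin M K" "K \<noteq> {}" and ns: "nonsaddle_set M \<phi> K"
  shows "\<nexists>x. dissonant_point M \<phi> K x"
    and "\<forall>U\<in>components_in M (topspace M - K). locally_attracted M \<phi> K U \<or> locally_repelled M \<phi> K U"
proof -
  obtain W where W: "openin M W" "K \<subseteq> W" "path_connectedin M W" "W \<subseteq> pos_part \<phi> N \<union> neg_part \<phi> N"
    using one_sided_neighbourhood[OF lpc K ns] .
  note side = complement_component_one_sided[OF lift norm lpc W]
  have "\<not> dissonant_point M \<phi> K x" for x
  proof (cases "x \<in> topspace M - K")
    case True
    then have "x \<in> \<Union> (connected_components_of (subtopology M (topspace M - K)))"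
      by (simp add: Union_connected_components_of)
    then obtain U where U: "U \<in> components_in M (topspace M - K)" "x \<in> U"
      by (auto simp: components_in_def)
    from side[OF U(1)] show ?thesis
      using attracted_side.not_dissonant U(2) dissonant_point_reversed by metis
  next
    case False
    moreover have "x \<in> topspace M" if "dissonant_point M \<phi> K x"
      using that by (auto simp: dissonant_point_def positively_dissonant_def negatively_dissonant_def
          externally_dissonant_def influence_region_def attraction_region_def repulsion_region_def)
    ultimately show ?thesis using K_not_dissonant by blast
  qed
  then show "\<nexists>x. dissonant_point M \<phi> K x" by blast
  have rev: "locally_attracted M (reversed_flow \<phi>) K U = locally_repelled M \<phi> K U" for U
    by (simp add: locally_attracted_def locally_repelled_def limit_regions_reversed)
  show "\<forall>U\<in>components_in M (topspace M - K). locally_attracted M \<phi> K U \<or> locally_repelled M \<phi> K U"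
    using side attracted_side.locally_attracted rev by metis
qed

end

section \<open>Isolating blocks\<close>

context isolated_flow
begin

lemma isolating_blockE:
  assumes "isolating_block M \<phi> K N"
  obtains Ni No where "compactin M Ni" "compactin M No" "M frontier_of N = Ni \<union> No"
    "\<forall>x\<in>Ni. \<exists>\<epsilon>>0. \<phi> x ` {- \<epsilon>..<0} \<subseteq> topspace M - N"
    "\<forall>x\<in>No. \<exists>\<delta>>0. \<phi> x ` {0<..\<delta>} \<subseteq> topspace M - N"
    "\<forall>x\<in>M frontier_of N - Ni. \<exists>\<epsilon>>0. \<phi> x ` {- \<epsilon>..<0} \<subseteq> M interior_of N"
    "\<forall>x\<in>M frontier_of N - No. \<exists>\<delta>>0. \<phi> x ` {0<..\<delta>} \<subseteq> M interior_of N"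
  using assms unfolding isolating_block_def by (elim exE conjE) (rule that)

lemma isolating_block_reversed:
  assumes "isolating_block M \<phi> K N"
  shows "isolating_block M (reversed_flow \<phi>) K N"
proof -
  interpret rev: isolated_flow M "reversed_flow \<phi>" K N by (rule isolated_flow_reversed)
  have im: "reversed_flow \<phi> x ` {- e..<0} = \<phi> x ` {0<..e}"
    "reversed_flow \<phi> x ` {0<..e} = \<phi> x ` {- e..<0}" for x e
  proof -
    have "reversed_flow \<phi> x ` S = \<phi> x ` uminus ` S" for S
      by (auto simp: reversed_flow_def image_image)
    then show "reversed_flow \<phi> x ` {- e..<0} = \<phi> x ` {0<..e}"
      "reversed_flow \<phi> x ` {0<..e} = \<phi> x ` {- e..<0}" by simp_all
  qed
  show ?thesis
    using assms
  proof (rule isolating_blockE)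
    fix Ni No
    assume "compactin M Ni" "compactin M No" "M frontier_of N = Ni \<union> No"
      "\<forall>x\<in>Ni. \<exists>\<epsilon>>0. \<phi> x ` {- \<epsilon>..<0} \<subseteq> topspace M - N"
      "\<forall>x\<in>No. \<exists>\<delta>>0. \<phi> x ` {0<..\<delta>} \<subseteq> topspace M - N"
      "\<forall>x\<in>M frontier_of N - Ni. \<exists>\<epsilon>>0. \<phi> x ` {- \<epsilon>..<0} \<subseteq> M interior_of N"
      "\<forall>x\<in>M frontier_of N - No. \<exists>\<delta>>0. \<phi> x ` {0<..\<delta>} \<subseteq> M interior_of N"
    then show ?thesis
      using rev.isolating unfolding isolating_block_def im
      by (intro conjI exI[of _ No] exI[of _ Ni]) (assumption | simp add: Un_commute)+
  qed
qed

text \<open>A point of \<open>N\<^sup>+\<close> does not leave \<open>N\<close> in forward time, so on the frontier it must belong to the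
entrance set.\<close>

lemma forward_frontier_point_exits_backward:
  assumes block: "isolating_block M \<phi> K N"
    and a: "a \<in> M frontier_of N" "a \<in> pos_part \<phi> N"
  obtains e where "0 < e" "\<And>t. 0 < t \<Longrightarrow> t \<le> e \<Longrightarrow> \<phi> a (- t) \<notin> N"
proof -
  obtain Ni No where fr: "M frontier_of N = Ni \<union> No"
    and Ni: "\<forall>x\<in>Ni. \<exists>\<epsilon>>0. \<phi> x ` {- \<epsilon>..<0} \<subseteq> topspace M - N"
    and No: "\<forall>x\<in>No. \<exists>\<delta>>0. \<phi> x ` {0<..\<delta>} \<subseteq> topspace M - N"
    using block by (rule isolating_blockE)
  have "a \<notin> No"
  proof
    assume "a \<in> No"
    then obtain d where "0 < d" "\<phi> a ` {0<..d} \<subseteq> topspace M - N" using No by blast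
    then have "\<phi> a d \<notin> N" by (auto simp: image_subset_iff)
    then show False using a(2) \<open>0 < d\<close> by (auto simp: in_pos_part_iff)
  qed
  then obtain e where "0 < e" "\<phi> a ` {- e..<0} \<subseteq> topspace M - N"
    using a(1) fr Ni by blast
  then show thesis by (intro that[of e]) (auto simp: image_subset_iff)
qed

text \<open>If one of the two frontier points were strictly later on the orbit than the other, it would have
been in \<open>N\<close> just before, although it has just entered \<open>N\<close>.\<close>

lemma forward_frontier_point_unique:
  assumes block: "isolating_block M \<phi> K N"
    and a: "a \<in> M frontier_of N" "a \<in> pos_part \<phi> N" and b: "b \<in> M frontier_of N" "b \<in> pos_part \<phi> N"
    and st: "0 \<le> t" "0 \<le> s" "\<phi> a t = \<phi> b s"
  shows "a = b"
proof -
  have le: "a = b" if a: "a \<in> M frontier_of N" "a \<in> pos_part \<phi> N" and b: "b \<in> pos_part \<phi> N"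
    and st: "0 \<le> t" "t \<le> s" "\<phi> a t = \<phi> b s" for a b t s
  proof -
    have top: "a \<in> topspace M" "b \<in> topspace M" using a b by (auto simp: in_pos_part_iff)
    have "\<phi> (\<phi> a t) (- t) = \<phi> (\<phi> b s) (- t)" using st by simp
    then have ab: "a = \<phi> b (s - t)" using top by simp
    obtain e where e: "0 < e" "\<And>r. 0 < r \<Longrightarrow> r \<le> e \<Longrightarrow> \<phi> a (- r) \<notin> N"
      using forward_frontier_point_exits_backward[OF block a] by blast
    have "s - t \<le> 0"
    proof (rule ccontr)
      assume "\<not> s - t \<le> 0"
      then have r: "0 < min e (s - t)" "min e (s - t) \<le> e" "0 \<le> s - t - min e (s - t)"
        using e(1) by auto
      then have "\<phi> b (s - t - min e (s - t)) \<in> N"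
        using b by (simp add: in_pos_part_iff)
      then show False using e(2)[OF r(1,2)] ab top by simp
    qed
    then have "s = t" using st by simp
    then show ?thesis using ab top by simp
  qed
  show ?thesis
    using le[OF a b(2) st(1) _ st(3)] le[OF b a(2) st(2) _ st(3)[symmetric]] by (metis linear)
qed

text \<open>Follow \<open>x\<close> backwards to the first time \<open>s\<close> at which its orbit is in \<open>N\<^sup>+\<close>; this time exists because
\<open>x \<notin> N\<^sup>-\<close> and \<open>N\<^sup>+\<close> is closed.  At an interior point of \<open>N\<close> one could go back further.\<close>

lemma forward_point_reaches_frontier:
  assumes x: "x \<in> pos_part \<phi> N" "x \<notin> K"
  obtains a t where "a \<in> M frontier_of N" "a \<in> pos_part \<phi> N" "0 \<le> t" "x = \<phi> a t"
proof -
  have xt: "x \<in> topspace M" using x by (simp add: in_pos_part_iff)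
  let ?J = "{s. \<phi> x s \<in> pos_part \<phi> N}"
  have "x \<notin> neg_part \<phi> N" using x pos_part_Int_neg_part by blast
  then obtain T where T: "\<phi> x T \<notin> N" using xt by (auto simp: in_neg_part_iff)
  have "T \<le> s" if "s \<in> ?J" for s
  proof (rule ccontr)
    assume "\<not> T \<le> s"
    then have "\<phi> (\<phi> x s) (T - s) \<in> N" using that unfolding in_pos_part_iff by simp
    then show False using T xt by simp
  qed
  then have bdd: "bdd_below ?J" by (auto simp: bdd_below_def)
  have ne: "0 \<in> ?J" using x xt by simp
  define s where "s = Inf ?J"
  have sJ: "s \<in> ?J" unfolding s_def
    using closed_contains_Inf[OF _ bdd closed_orbit_preimage[OF xt closed_pos_part]] ne by blast
  have s0: "s \<le> 0" unfolding s_def using cInf_lower[OF ne bdd] .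
  have "\<phi> x s \<notin> M interior_of N"
  proof
    assume "\<phi> x s \<in> M interior_of N"
    then have "open {r. \<phi> x r \<in> M interior_of N}" "s \<in> {r. \<phi> x r \<in> M interior_of N}"
      using open_orbit_preimage[OF xt] by auto
    then obtain e where e: "0 < e" "\<And>r. dist r s < e \<Longrightarrow> \<phi> x r \<in> M interior_of N"
      unfolding open_dist by auto
    have "\<phi> x (s - e / 2) \<in> pos_part \<phi> N"
      unfolding in_pos_part_iff
    proof (intro conjI allI impI)
      show "\<phi> x (s - e / 2) \<in> topspace M" using xt by simp
      fix t :: real assume t: "0 \<le> t"
      show "\<phi> (\<phi> x (s - e / 2)) t \<in> N"
      proof (cases "t \<le> e / 2")
        case True
        then have "dist (s - e / 2 + t) s < e" using e(1) t by (simp add: dist_real_def)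
        then show ?thesis using e(2) interior_of_subset[of M N] xt by auto
      next
        case False
        then have "\<phi> (\<phi> x s) (t - e / 2) \<in> N" using sJ by (simp add: in_pos_part_iff)
        then show ?thesis using xt by (simp add: algebra_simps)
      qed
    qed
    then have "s \<le> s - e / 2" unfolding s_def by (intro cInf_lower bdd) simp
    then show False using e(1) by simp
  qed
  moreover have "\<phi> x s \<in> N" using sJ pos_part_subset by blast
  ultimately have "\<phi> x s \<in> M frontier_of N"
    using closure_of_subset[OF N_subset] by (auto simp: frontier_of_def)
  then show thesis
    using sJ s0 xt by (intro that[of "\<phi> x s" "- s"]) auto
qed

definition forward_saturation :: "'a set \<Rightarrow> 'a set" where
  "forward_saturation A = (\<lambda>(a, t). \<phi> a t) ` ((A \<inter> pos_part \<phi> N) \<times> {0..})"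

lemma forward_saturation_subset: "forward_saturation A \<subseteq> pos_part \<phi> N"
  by (auto simp: forward_saturation_def flow_in_pos_part)

text \<open>A limit \<open>x \<notin> K\<close> of the saturation is in \<open>N\<^sup>+\<close>, hence outside \<open>N\<close> at some time \<open>T \<le> 0\<close>, and so are its
neighbours.  Neighbours \<open>\<phi>(a, t)\<close> of \<open>x\<close> in the saturation thus have \<open>t \<le> - T\<close>: near \<open>x\<close> the saturation
is the image of a compact set.\<close>

lemma closed_forward_saturation:
  assumes A: "closedin M A"
  shows "closedin M (K \<union> forward_saturation A)"
proof -
  let ?S = "forward_saturation A" and ?Ap = "A \<inter> pos_part \<phi> N"
  have "closedin M ?Ap" using A closed_pos_part by (rule closedin_Int)
  then have cA: "compactin M ?Ap"
    using compact_N pos_part_subset by (meson closed_compactin inf.coboundedI2)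
  have "x \<in> K \<union> ?S" if x: "x \<in> M closure_of ?S" for x
  proof (rule ccontr)
    assume n: "x \<notin> K \<union> ?S"
    have xp: "x \<in> pos_part \<phi> N"
      using closure_of_minimal[OF forward_saturation_subset closed_pos_part] x by blast
    then have xt: "x \<in> topspace M" by (simp add: in_pos_part_iff)
    have "x \<notin> neg_part \<phi> N" using xp n pos_part_Int_neg_part by blast
    then obtain T where T: "T \<le> 0" "\<phi> x T \<notin> N" using xt by (auto simp: in_neg_part_iff)
    let ?B = "{u \<in> topspace M. \<phi> u T \<in> topspace M - N}"
    let ?C = "(\<lambda>(a, t). \<phi> a t) ` (?Ap \<times> {0..- T})"
    have oB: "openin M ?B" using closed_N by (intro openin_time_preimage) auto
    have xB: "x \<in> ?B" using xt T by simp
    have "compactin (prod_topology M euclideanreal) (?Ap \<times> {0..- T})"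
      using cA by (simp add: compactin_Times)
    then have "compactin M ?C" using flow_continuous by (rule image_compactin)
    then have cC: "closedin M ?C" using hausdorff compactin_imp_closedin by blast
    have "?S \<inter> ?B \<subseteq> ?C"
    proof
      fix u assume u: "u \<in> ?S \<inter> ?B"
      then obtain a t where at: "a \<in> ?Ap" "0 \<le> t" "u = \<phi> a t"
        by (auto simp: forward_saturation_def)
      have "t \<le> - T"
      proof (rule ccontr)
        assume "\<not> t \<le> - T"
        then have "\<phi> a (t + T) \<in> N" using at by (simp add: in_pos_part_iff)
        then show False using u at by (simp add: in_pos_part_iff)
      qed
      then show "u \<in> ?C" using at by auto
    qed
    moreover have "?C \<subseteq> ?S" by (auto simp: forward_saturation_def)
    ultimately have "x \<notin> ?C" "?S \<inter> (?B - ?C) = {}" using n by auto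
    moreover have "openin M (?B - ?C)" using oB cC by (rule openin_diff)
    ultimately show False
      using closure_of_meets_open[OF x, of "?B - ?C"] xB by blast
  qed
  then have "K \<union> M closure_of ?S = K \<union> ?S"
    using closure_of_subset[of ?S M] forward_saturation_subset pos_part_subset N_subset by blast
  moreover have "closedin M (K \<union> M closure_of ?S)" using closed_K by (simp add: closedin_Un)
  ultimately show ?thesis by simp
qed

lemma forward_saturation_disjoint:
  assumes "isolating_block M \<phi> K N" "A \<subseteq> M frontier_of N" "B \<subseteq> M frontier_of N" "A \<inter> B = {}"
  shows "forward_saturation A \<inter> forward_saturation B = {}"
proof (rule ccontr)
  assume "forward_saturation A \<inter> forward_saturation B \<noteq> {}"
  then obtain x where "x \<in> forward_saturation A" "x \<in> forward_saturation B" by blast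
  then obtain a t b s where "a \<in> A" "a \<in> pos_part \<phi> N" "0 \<le> t" "b \<in> B" "b \<in> pos_part \<phi> N" "0 \<le> s"
    "\<phi> a t = \<phi> b s"
    unfolding forward_saturation_def by auto
  then have "a = b"
    using forward_frontier_point_unique[OF assms(1)] assms(2,3) by blast
  then show False using \<open>a \<in> A\<close> \<open>b \<in> B\<close> assms(4) by blast
qed

text \<open>In the compact space \<open>\<partial>N\<close> components and quasi-components coincide, so \<open>C\<^sub>1\<close> and \<open>C\<^sub>2\<close> are
separated by a partition of \<open>\<partial>N\<close> into closed sets \<open>A\<close> and \<open>B\<close>.  Sweeping \<open>A\<close> and \<open>B\<close> along the flow,
forwards within \<open>N\<^sup>+\<close> and backwards within \<open>N\<^sup>-\<close>, splits \<open>N - K\<close> in the same way.  The orbits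
through \<open>C\<^sub>1\<close> and \<open>C\<^sub>2\<close> enter both halves near \<open>K\<close> without leaving the components of \<open>M - K\<close> that
contain them.\<close>

theorem frontier_components_separated:
  assumes lift: "circle_lifting M" and norm: "normal_space M" and lpc: "locally_path_connected_space M"
    and K: "connectedin M K" "K \<noteq> {}"
    and block: "isolating_block M \<phi> K N" and N: "N = pos_part \<phi> N \<union> neg_part \<phi> N"
    and C: "C\<^sub>1 \<in> components_in M (M frontier_of N)" "C\<^sub>2 \<in> components_in M (M frontier_of N)" "C\<^sub>1 \<noteq> C\<^sub>2"
    and U: "U \<in> components_in M (topspace M - K)" "C\<^sub>1 \<subseteq> U"
  shows "\<not> C\<^sub>2 \<subseteq> U"
proof
  assume C2U: "C\<^sub>2 \<subseteq> U"
  interpret rev: isolated_flow M "reversed_flow \<phi>" K N by (rule isolated_flow_reversed)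
  let ?F = "M frontier_of N"
  let ?X = "subtopology M ?F"
  have FN: "?F \<subseteq> N" using frontier_of_subset_closedin[OF closed_N] .
  have FK: "?F \<inter> K = {}" using K_interior by (auto simp: frontier_of_def)
  have topX: "topspace ?X = ?F" using FN N_subset by auto
  have FC: "closedin M ?F" by (rule closedin_frontier_of)
  have "compactin M ?F" using compact_N FN FC by (meson closed_compactin)
  then have cX: "compact_space ?X" by (simp add: compactin_subspace)
  have hX: "Hausdorff_space ?X" using hausdorff by (rule Hausdorff_space_subtopology)
  have quasi: "C \<in> quasi_components_of ?X" if "C \<in> components_in M ?F" for C
  proof -
    have "closedin ?X C"
      using that unfolding components_in_def by (rule closedin_connected_components_of)
    then have "compactin ?X C" using cX closedin_compact_space by blast
    then show ?thesis
      using compact_quasi_eq_connected_components_of[OF _ hX] that cX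
      by (auto simp: components_in_def compact_imp_locally_compact_space)
  qed
  have "separated_between ?X C\<^sub>1 C\<^sub>2"
    using C quasi separated_between_quasi_components[of C\<^sub>1 ?X C\<^sub>2]
      pairwise_disjoint_quasi_components_of[of ?X] by (auto simp: pairwise_def)
  then obtain A B where AB: "openin ?X A" "openin ?X B" "A \<union> B = ?F" "A \<inter> B = {}" "C\<^sub>1 \<subseteq> A" "C\<^sub>2 \<subseteq> B"
    unfolding separated_between_def topX disjnt_def by blast
  have "A = ?F - B" "B = ?F - A" using AB by auto
  then have "closedin ?X A" "closedin ?X B"
    using AB(1,2) topX by (metis closedin_def closedin_diff closedin_topspace)+
  then have cAB: "closedin M A" "closedin M B"
    using FC closedin_closed_subtopology by blast+
  let ?sat = "\<lambda>A. forward_saturation A \<union> rev.forward_saturation A"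
  have rev_sub: "rev.forward_saturation S \<subseteq> neg_part \<phi> N" for S
    using rev.forward_saturation_subset by (simp add: pos_part_reversed)
  have closed_sat: "closedin M (K \<union> ?sat S)" if "closedin M S" for S
  proof -
    have "K \<union> ?sat S = (K \<union> forward_saturation S) \<union> (K \<union> rev.forward_saturation S)" by blast
    then show ?thesis
      using closed_forward_saturation[OF that] rev.closed_forward_saturation[OF that]
      by (simp add: closedin_Un)
  qed
  have reach: "x \<in> ?sat A \<union> ?sat B" if x: "x \<in> N" "x \<notin> K" for x
  proof -
    consider "x \<in> pos_part \<phi> N" | "x \<in> pos_part (reversed_flow \<phi>) N"
      using x N by (auto simp: pos_part_reversed)
    then show ?thesis
    proof cases
      case 1
      then obtain a t where "a \<in> ?F" "a \<in> pos_part \<phi> N" "0 \<le> t" "x = \<phi> a t"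
        using forward_point_reaches_frontier x(2) by blast
      then show ?thesis using AB(3) by (auto simp: forward_saturation_def)
    next
      case 2
      then obtain a t where "a \<in> ?F" "a \<in> pos_part (reversed_flow \<phi>) N" "0 \<le> t" "x = reversed_flow \<phi> a t"
        using rev.forward_point_reaches_frontier x(2) by blast
      then show ?thesis using AB(3) by (auto simp: rev.forward_saturation_def)
    qed
  qed
  have sat_K: "?sat S \<inter> K = {}" if "S \<subseteq> ?F" for S
  proof -
    have "\<phi> a t \<notin> K" "reversed_flow \<phi> a t \<notin> K" if "a \<in> S" for a t
    proof -
      have "a \<in> topspace M" "a \<notin> K" using that \<open>S \<subseteq> ?F\<close> FN FK N_subset by auto
      then show "\<phi> a t \<notin> K" "reversed_flow \<phi> a t \<notin> K"
        using flow_in_K_iff rev.flow_in_K_iff by auto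
    qed
    then show ?thesis by (auto simp: forward_saturation_def rev.forward_saturation_def)
  qed
  have AF: "A \<subseteq> ?F" "B \<subseteq> ?F" using AB by auto
  have same: "forward_saturation A \<inter> forward_saturation B = {}"
    using forward_saturation_disjoint[OF block AF AB(4)] .
  have rsame: "rev.forward_saturation A \<inter> rev.forward_saturation B = {}"
    using rev.forward_saturation_disjoint[OF isolating_block_reversed[OF block] AF AB(4)] .
  have disj: "?sat A \<inter> ?sat B = {}"
    using same rsame rev_sub[of A] rev_sub[of B] forward_saturation_subset[of A]
      forward_saturation_subset[of B] pos_part_Int_neg_part sat_K[OF AF(1)] sat_K[OF AF(2)]
    by blast
  obtain W where W: "openin M W" "K \<subseteq> W" "W \<subseteq> M interior_of N" "path_connectedin M W"
    using path_connected_open_neighbourhood[OF lpc K openin_interior_of K_interior] .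
  have WN: "W \<subseteq> N" using W(3) interior_of_subset[of M N] by blast
  note U' = complement_component[OF lpc U(1)]
  have one_side: "U \<inter> (W - (K \<union> ?sat B)) = {} \<or> U \<inter> (W - (K \<union> ?sat A)) = {}"
  proof (rule no_component_meets_both_sides[OF lift norm closed_K W(1,2,4) _ _ _ _ U'(2,3)])
    show "openin M (W - (K \<union> ?sat B))" "openin M (W - (K \<union> ?sat A))"
      using W(1) closed_sat cAB by (auto intro: openin_diff)
    show "(W - (K \<union> ?sat B)) \<inter> (W - (K \<union> ?sat A)) = {}"
      using reach WN by blast
    show "W - K = (W - (K \<union> ?sat B)) \<union> (W - (K \<union> ?sat A))"
      using disj by blast
  qed
  have enter: "U \<inter> W \<inter> ?sat S \<noteq> {}" if S: "c \<in> S" "c \<in> U" "S \<subseteq> ?F" for c S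
  proof -
    consider "c \<in> pos_part \<phi> N" | "c \<in> pos_part (reversed_flow \<phi>) N"
      using S FN N by (auto simp: pos_part_reversed)
    then show ?thesis
    proof cases
      case 1
      then obtain t where t: "0 \<le> t" "\<phi> c t \<in> W"
        using attracted_point_enters[OF _ W(1,2), of c 0] pos_part_subset_attraction_region by blast
      then have "\<phi> c t \<in> U \<inter> W \<inter> ?sat S"
        using U'(4) S 1 by (auto simp: forward_saturation_def)
      then show ?thesis by blast
    next
      case 2
      then obtain t where t: "0 \<le> t" "reversed_flow \<phi> c t \<in> W"
        using rev.attracted_point_enters[OF _ W(1,2), of c 0] rev.pos_part_subset_attraction_region by blast
      moreover have "reversed_flow \<phi> c t \<in> U" using U'(4) S by (simp add: reversed_flow_def)
      ultimately have "reversed_flow \<phi> c t \<in> U \<inter> W \<inter> ?sat S"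
        using S 2 by (auto simp: rev.forward_saturation_def)
      then show ?thesis by blast
    qed
  qed
  obtain c1 c2 where "c1 \<in> C\<^sub>1" "c2 \<in> C\<^sub>2"
    using C nonempty_connected_components_of unfolding components_in_def by blast
  then have "c1 \<in> A" "c1 \<in> U" "c2 \<in> B" "c2 \<in> U" using AB(5,6) U(2) C2U by auto
  then obtain x y where "x \<in> U \<inter> W \<inter> ?sat A" "y \<in> U \<inter> W \<inter> ?sat B"
    using enter[of c1 A] enter[of c2 B] AF by blast
  then have "x \<in> U \<inter> (W - (K \<union> ?sat B))" "y \<in> U \<inter> (W - (K \<union> ?sat A))"
    using disj U'(3) by auto
  with one_side show False by blast
qed

theorem frontier_components_in_different_complement_components:
  assumes lift: "circle_lifting M" and norm: "normal_space M" and lpc: "locally_path_connected_space M"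
    and K: "connectedin M K" "K \<noteq> {}"
    and block: "isolating_block M \<phi> K N" and N: "N = pos_part \<phi> N \<union> neg_part \<phi> N"
    and C: "C\<^sub>1 \<in> components_in M (M frontier_of N)" "C\<^sub>2 \<in> components_in M (M frontier_of N)" "C\<^sub>1 \<noteq> C\<^sub>2"
  shows "\<exists>U\<^sub>1\<in>components_in M (topspace M - K). \<exists>U\<^sub>2\<in>components_in M (topspace M - K).
           C\<^sub>1 \<subseteq> U\<^sub>1 \<and> C\<^sub>2 \<subseteq> U\<^sub>2 \<and> U\<^sub>1 \<noteq> U\<^sub>2"
proof -
  have ex: "\<exists>U\<in>components_in M (topspace M - K). C \<subseteq> U" if "C \<in> components_in M (M frontier_of N)" for C
  proof -
    have c: "connectedin M C" "C \<subseteq> M frontier_of N"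
      using connectedin_connected_components_of[of C "subtopology M (M frontier_of N)"] that
      by (auto simp: components_in_def connectedin_subtopology)
    have "C \<subseteq> topspace M - K"
      using c(2) K_interior frontier_of_subset_topspace[of M N] by (auto simp: frontier_of_def)
    then have "connectedin (subtopology M (topspace M - K)) C"
      using c(1) by (simp add: connectedin_subtopology)
    moreover have "topspace (subtopology M (topspace M - K)) \<noteq> {}"
      using \<open>C \<subseteq> topspace M - K\<close> that nonempty_connected_components_of[of C]
      by (auto simp: components_in_def)
    ultimately show ?thesis
      using exists_connected_component_of_superset unfolding components_in_def by (metis null_topspace_iff_trivial)
  qed
  then show ?thesis
    using C frontier_components_separated[OF assms] by metis
qed

end

section \<open>Manifolds and Euclidean spaces\<close>

lemma locally_path_connected_topological_manifold:
  assumes "topological_manifold n M"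
  shows "locally_path_connected_space M"
  unfolding locally_path_connected_space
proof (intro allI impI)
  fix V x assume V: "openin M V \<and> x \<in> V"
  then have "x \<in> topspace M" using openin_subset by blast
  then obtain A B where A: "openin M A" "x \<in> A" and B: "openin (Euclidean_space n) B"
    and AB: "subtopology M A homeomorphic_space subtopology (Euclidean_space n) B"
    using assms unfolding topological_manifold_def by blast
  have "locally_path_connected_space (subtopology M A)"
    unfolding homeomorphic_locally_path_connected_space[OF AB]
    using locally_path_connected_space_open_subset[OF locally_path_connected_Euclidean_space B] .
  moreover have "openin (subtopology M A) (V \<inter> A)" "x \<in> V \<inter> A"
    using V A by (auto intro: openin_subtopology_Int)
  ultimately obtain U where "openin (subtopology M A) U" "path_connectedin (subtopology M A) U"
    "x \<in> U" "U \<subseteq> V \<inter> A"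
    unfolding locally_path_connected_space by blast
  then show "\<exists>U. openin M U \<and> path_connectedin M U \<and> x \<in> U \<and> U \<subseteq> V"
    using A(1) openin_open_subtopology path_connectedin_subtopology by (metis le_inf_iff)
qed

text \<open>The sign is passed as a factor \<open>s\<close> so that both half-spaces of a coordinate are covered at once.\<close>

lemma connectedin_half_space:
  "connectedin (Euclidean_space n) {x \<in> topspace (Euclidean_space n). r < s * x i}"
proof -
  let ?H = "{x \<in> topspace (Euclidean_space n). r < s * x i}"
  have "path_connectedin (Euclidean_space n) ?H"
    unfolding path_connectedin
  proof (intro conjI ballI)
    fix x y assume xy: "x \<in> ?H" "y \<in> ?H"
    define p where "p t = (\<lambda>k. (1 - t) * x k + t * y k)" for t :: real
    have "continuous_map (top_of_set {0..1}) euclideanreal (\<lambda>t. p t k)" for k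
      unfolding p_def by (simp, intro continuous_intros)
    then have "pathin (Euclidean_space n) p"
      using xy by (auto simp: pathin_def Euclidean_space_def continuous_map_in_subtopology
          continuous_map_componentwise_UNIV p_def)
    moreover have "p t \<in> ?H" if "t \<in> {0..1}" for t
    proof -
      have "r < (1 - t) * (s * x i) + t * (s * y i)"
        using xy that convex_bound_lt[of "- (s * x i)" "- r" "- (s * y i)" "1 - t" t] by simp
      then show ?thesis
        using xy by (auto simp: p_def topspace_Euclidean_space algebra_simps)
    qed
    ultimately show "\<exists>g. pathin (Euclidean_space n) g \<and> g \<in> {0..1} \<rightarrow> ?H \<and> g 0 = x \<and> g 1 = y"
      by (intro exI[of _ p]) (auto simp: p_def)
  qed auto
  then show ?thesis by (rule path_connectedin_imp_connectedin)
qed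

definition cube :: "nat \<Rightarrow> real \<Rightarrow> (nat \<Rightarrow> real) set" where
  "cube n r = {x \<in> topspace (Euclidean_space n). \<forall>i<n. \<bar>x i\<bar> \<le> r}"

lemma compactin_cube: "compactin (Euclidean_space n) (cube n r)"
proof -
  have "compactin (powertop_real UNIV) (PiE UNIV (\<lambda>i. if i < n then {-r..r} else {0}))"
    by (subst compactin_PiE) auto
  moreover have "x \<in> cube n r \<longleftrightarrow> (\<forall>i. x i \<in> (if i < n then {-r..r} else {0}))" for x
  proof -
    have "(\<forall>i. x i \<in> (if i < n then {-r..r} else {0})) \<longleftrightarrow> (\<forall>i. (n \<le> i \<longrightarrow> x i = 0) \<and> (i < n \<longrightarrow> \<bar>x i\<bar> \<le> r))"
      by (intro all_cong1) (auto simp: abs_le_iff)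
    then show ?thesis by (auto simp: cube_def topspace_Euclidean_space)
  qed
  then have "cube n r = PiE UNIV (\<lambda>i. if i < n then {-r..r} else {0})"
    unfolding set_eq_iff PiE_iff by simp
  ultimately show ?thesis
    by (auto simp: Euclidean_space_def compactin_subtopology cube_def topspace_Euclidean_space)
qed

lemma compactin_subset_cube:
  assumes "compactin (Euclidean_space n) K"
  obtains r where "0 \<le> r" "K \<subseteq> cube n r"
proof -
  have "\<exists>b. \<forall>x\<in>K. \<bar>x i\<bar> \<le> b" for i
  proof -
    have "continuous_map (Euclidean_space n) euclideanreal (\<lambda>x. x i)"
      unfolding Euclidean_space_def
      by (intro continuous_map_from_subtopology continuous_map_product_projection) simp
    from image_compactin[OF assms this] have "compact ((\<lambda>x. x i) ` K)"
      by simp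
    then show ?thesis
      using compact_imp_bounded[of "(\<lambda>x. x i) ` K"] by (auto simp: bounded_iff)
  qed
  then obtain b where b: "\<And>i x. x \<in> K \<Longrightarrow> \<bar>x i\<bar> \<le> b i" by metis
  let ?r = "\<Sum>i<n. \<bar>b i\<bar>"
  have "\<bar>x i\<bar> \<le> ?r" if "x \<in> K" "i < n" for x i
    using b[OF that(1), of i] member_le_sum[of i "{..<n}" "\<lambda>i. \<bar>b i\<bar>"] that(2) by fastforce
  then have "K \<subseteq> cube n ?r"
    using compactin_subset_topspace[OF assms] by (auto simp: cube_def)
  then show thesis by (intro that[of ?r]) (auto simp: sum_nonneg)
qed

text \<open>The complement of the cube is the union of the half-spaces \<open>H i s\<close>, where \<open>\<plusminus>x\<^sub>i > r\<close>.  Half-spaces of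
different coordinates intersect, and opposite half-spaces are joined through a second coordinate, which
exists because \<open>n \<ge> 2\<close>.\<close>

lemma connectedin_complement_cube:
  assumes n: "2 \<le> n" and r: "0 \<le> r"
  shows "connectedin (Euclidean_space n) (topspace (Euclidean_space n) - cube n r)"
proof -
  let ?E = "Euclidean_space n" and ?S = "topspace (Euclidean_space n) - cube n r"
  let ?X = "subtopology ?E ?S"
  define H where "H i s = {x \<in> topspace ?E. r < s * x i}" for i :: nat and s :: real
  have HS: "H i s \<subseteq> ?S" if "i < n" "s = 1 \<or> s = - 1" for i s
    using that by (force simp: H_def cube_def)
  have conn: "connectedin ?E (H i s)" for i s
    unfolding H_def by (rule connectedin_half_space)
  have meet: "H i s \<inter> H j s' \<noteq> {}" if "i \<noteq> j" "i < n" "j < n" "s = 1 \<or> s = - 1" "s' = 1 \<or> s' = - 1" for i j s s'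
  proof -
    have "(\<lambda>k. if k = i then s * (r + 1) else if k = j then s' * (r + 1) else 0) \<in> H i s \<inter> H j s'"
      using that by (auto simp: H_def topspace_Euclidean_space)
    then show ?thesis by blast
  qed
  have "connected_space ?X"
    unfolding connected_space_subconnected
  proof (intro ballI)
    fix x y assume "x \<in> topspace ?X" "y \<in> topspace ?X"
    have in_H: "\<exists>i s. i < n \<and> (s = 1 \<or> s = - 1) \<and> z \<in> H i s" if z: "z \<in> topspace ?X" for z
    proof -
      obtain i where i: "i < n" "r < \<bar>z i\<bar>" "z \<in> topspace ?E" using z by (auto simp: cube_def not_le)
      show ?thesis
      proof (cases "0 \<le> z i")
        case True
        then show ?thesis using i by (intro exI[of _ i] exI[of _ 1]) (auto simp: H_def)
      next
        case False
        then show ?thesis using i by (intro exI[of _ i] exI[of _ "- 1"]) (auto simp: H_def)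
      qed
    qed
    obtain i s where i: "i < n" "s = 1 \<or> s = - 1" "x \<in> H i s"
      using in_H[OF \<open>x \<in> topspace ?X\<close>] by blast
    obtain j s' where j: "j < n" "s' = 1 \<or> s' = - 1" "y \<in> H j s'"
      using in_H[OF \<open>y \<in> topspace ?X\<close>] by blast
    show "\<exists>T. connectedin ?X T \<and> x \<in> T \<and> y \<in> T"
    proof (cases "i = j")
      case False
      then have "connectedin ?E (H i s \<union> H j s')"
        using meet i j by (intro connectedin_Un conn) auto
      then show ?thesis
        using i j HS by (intro exI[of _ "H i s \<union> H j s'"]) (auto simp: connectedin_subtopology)
    next
      case True
      define k :: nat where "k = (if i = 0 then 1 else 0)"
      have k: "k \<noteq> i" "k < n" using n by (auto simp: k_def)
      have "connectedin ?E (H i s \<union> H k 1)" "connectedin ?E (H k 1 \<union> H j s')"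
        using meet[of i k s 1] meet[of k j 1 s'] i j k True by (intro connectedin_Un conn; auto)+
      then have "connectedin ?E ((H i s \<union> H k 1) \<union> (H k 1 \<union> H j s'))"
        using meet[of i k s 1] i k by (intro connectedin_Un[of ?E "H i s \<union> H k 1"]) auto
      then show ?thesis
        using i j k HS[of i s] HS[of j s'] HS[of k 1]
        by (intro exI[of _ "(H i s \<union> H k 1) \<union> (H k 1 \<union> H j s')"]) (auto simp: connectedin_subtopology)
    qed
  qed
  then show ?thesis by (simp add: connectedin_def)
qed

lemma influence_region_reversed:
  "influence_region M (reversed_flow \<phi>) K = influence_region M \<phi> K"
  by (auto simp: influence_region_def limit_regions_reversed)

lemma (in attracted_side) component_not_in_compact:
  assumes I: "influence_region M \<phi> K = topspace M" and ne: "U \<noteq> {}" and C: "compactin M C"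
  shows "\<not> U \<subseteq> C"
proof -
  obtain x where "x \<in> U" using ne by blast
  then have "\<phi> x ` {..0} \<subseteq> U" using U_invariant by blast
  then show ?thesis using backward_orbit_not_in_compact[OF I \<open>x \<in> U\<close> C] by blast
qed

text \<open>Since no component of the complement of \<open>K\<close> lies in a cube around \<open>K\<close>, each one contains the
connected outside of the cube.  Hence there is only one component, and its side decides between the
two alternatives.\<close>

theorem Euclidean_global_attractor_or_repeller:
  fixes n :: nat
  defines "E \<equiv> Euclidean_space n"
  assumes n: "2 \<le> n" and "isolated_flow E \<phi> K N"
    and K: "connectedin E K" "K \<noteq> {}" "K \<noteq> topspace E" and ns: "nonsaddle_set E \<phi> K"
    and I: "influence_region E \<phi> K = topspace E"
  shows "stable_global_attractor E \<phi> K \<or> neg_stable_global_repeller E \<phi> K"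
proof -
  interpret isolated_flow E \<phi> K N by fact
  have lift: "circle_lifting E" and norm: "normal_space E" and lpc: "locally_path_connected_space E"
    by (simp_all add: E_def circle_lifting_Euclidean_space locally_path_connected_Euclidean_space
        metrizable_imp_normal_space metrizable_Euclidean_space)
  obtain W where W: "openin E W" "K \<subseteq> W" "path_connectedin E W" "W \<subseteq> pos_part \<phi> N \<union> neg_part \<phi> N"
    using one_sided_neighbourhood[OF lpc K(1,2) ns] .
  note side = complement_component_one_sided[OF lift norm lpc W]
  obtain r where r: "0 \<le> r" "K \<subseteq> cube n r"
    using compactin_subset_cube compact_K unfolding E_def by blast
  have cube: "compactin E (cube n r)" unfolding E_def by (rule compactin_cube)
  let ?X = "subtopology E (topspace E - K)"
  have out: "connectedin ?X (topspace E - cube n r)"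
    using connectedin_complement_cube[OF n r(1)] r(2)
    by (auto simp: E_def connectedin_subtopology)
  have outer: "topspace E - cube n r \<subseteq> U \<and> U - cube n r \<noteq> {}" if U: "U \<in> components_in E (topspace E - K)" for U
  proof -
    have "\<not> U \<subseteq> cube n r"
      using side[OF U] attracted_side.component_not_in_compact[OF _ _ complement_component(5)[OF lpc U] cube]
        I influence_region_reversed[of E \<phi> K] by metis
    then have "\<not> disjnt U (topspace E - cube n r)"
      using openin_subset[OF complement_component(1)[OF lpc U]] by (auto simp: disjnt_def)
    then show ?thesis
      using connected_components_of_maximal[OF U[unfolded components_in_def] out] \<open>\<not> U \<subseteq> cube n r\<close> by blast
  qed
  have tX: "topspace ?X = topspace E - K" by auto
  then obtain x where x: "x \<in> topspace ?X" using K(3) K_subset by blast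
  then obtain U where U: "U \<in> components_in E (topspace E - K)"
    unfolding components_in_def using Union_connected_components_of[of ?X] by blast
  have "V = U" if V: "V \<in> components_in E (topspace E - K)" for V
  proof -
    have "\<not> disjnt V U"
      using outer[OF V] outer[OF U] openin_subset[OF complement_component(1)[OF lpc V]]
      by (auto simp: disjnt_def)
    then show ?thesis
      using pairwise_disjoint_connected_components_of[of ?X] U V
      unfolding components_in_def pairwise_def by blast
  qed
  then have "components_in E (topspace E - K) = {U}" using U by blast
  then have UE: "U = topspace E - K"
    using Union_connected_components_of[of ?X] tX by (simp add: components_in_def)
  from side[OF U] show ?thesis
  proof
    assume "attracted_side E \<phi> K N U W"
    then show ?thesis
      using attracted_side.stable_global_attractor[OF _ UE I ns] by blast
  next
    assume "attracted_side E (reversed_flow \<phi>) K N U W"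
    then show ?thesis
      using attracted_side.stable_global_attractor[OF _ UE] I ns
      by (simp add: neg_stable_global_repeller_def influence_region_reversed nonsaddle_reversed)
  qed
qed

lemma isolated_flow_if_isolated_invariant_set:
  assumes "Hausdorff_space M" "flow M \<phi>" "isolated_invariant_set M \<phi> K"
  obtains N where "isolated_flow M \<phi> K N"
  using assms by (auto simp: isolated_invariant_set_def isolated_flow_def)

theorem theorem25:
  "(\<forall>(M :: 'a topology) \<phi> K.
      closed_manifold M \<and> connected_space M \<and> trivial_group (cohomology_group 1 M) \<and>
      flow M \<phi> \<and> isolated_invariant_set M \<phi> K \<and> nonsaddle_set M \<phi> K \<and> connectedin M K
      \<longrightarrow>
      (\<nexists>x. dissonant_point M \<phi> K x) \<and>
      (\<forall>U\<in>components_in M (topspace M - K).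
         locally_attracted M \<phi> K U \<or> locally_repelled M \<phi> K U) \<and>
      (\<forall>N. isolating_block M \<phi> K N \<and> N = pos_part \<phi> N \<union> neg_part \<phi> N \<longrightarrow>
         (\<forall>C\<^sub>1\<in>components_in M (M frontier_of N). \<forall>C\<^sub>2\<in>components_in M (M frontier_of N).
            C\<^sub>1 \<noteq> C\<^sub>2 \<longrightarrow>
            (\<exists>U\<^sub>1\<in>components_in M (topspace M - K). \<exists>U\<^sub>2\<in>components_in M (topspace M - K).
               C\<^sub>1 \<subseteq> U\<^sub>1 \<and> C\<^sub>2 \<subseteq> U\<^sub>2 \<and> U\<^sub>1 \<noteq> U\<^sub>2))))
   \<and>
   (\<forall>n \<phi> K.
      2 \<le> n \<and> flow (Euclidean_space n) \<phi> \<and>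
      isolated_invariant_set (Euclidean_space n) \<phi> K \<and> nonsaddle_set (Euclidean_space n) \<phi> K \<and>
      connectedin (Euclidean_space n) K
      \<longrightarrow>
      (\<nexists>x. dissonant_point (Euclidean_space n) \<phi> K x) \<and>
      (\<forall>U\<in>components_in (Euclidean_space n) (topspace (Euclidean_space n) - K).
         locally_attracted (Euclidean_space n) \<phi> K U \<or>
         locally_repelled (Euclidean_space n) \<phi> K U) \<and>
      (influence_region (Euclidean_space n) \<phi> K = topspace (Euclidean_space n) \<longrightarrow>
         stable_global_attractor (Euclidean_space n) \<phi> K \<or>
         neg_stable_global_repeller (Euclidean_space n) \<phi> K))"
proof (intro conjI[of "\<forall>M. _ M" "\<forall>n. _ n"] allI impI)
  fix M :: "'a topology" and \<phi> K
  assume asm: "closed_manifold M \<and> connected_space M \<and> trivial_group (cohomology_group 1 M) \<and>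
      flow M \<phi> \<and> isolated_invariant_set M \<phi> K \<and> nonsaddle_set M \<phi> K \<and> connectedin M K"
  then obtain d where cpt: "compact_space M" and man: "topological_manifold d M"
    by (auto simp: closed_manifold_def)
  have haus: "Hausdorff_space M" using man by (simp add: topological_manifold_def)
  have norm: "normal_space M"
    using compact_Hausdorff_or_regular_imp_normal_space cpt haus by blast
  have lpc: "locally_path_connected_space M"
    using locally_path_connected_topological_manifold[OF man] .
  have lift: "circle_lifting M"
    using asm circle_lifting_if_trivial_cohomology by blast
  have K: "connectedin M K" "K \<noteq> {}" and ns: "nonsaddle_set M \<phi> K" and fl: "flow M \<phi>"
    and iso: "isolated_invariant_set M \<phi> K"
    using asm by (auto simp: isolated_invariant_set_def)
  obtain N\<^sub>0 where "isolated_flow M \<phi> K N\<^sub>0"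
    using isolated_flow_if_isolated_invariant_set[OF haus fl iso] .
  note local_part = isolated_flow.no_dissonance_and_local_attraction_or_repulsion
      [OF this lift norm lpc K ns]
  have "\<exists>U\<^sub>1\<in>components_in M (topspace M - K). \<exists>U\<^sub>2\<in>components_in M (topspace M - K).
               C\<^sub>1 \<subseteq> U\<^sub>1 \<and> C\<^sub>2 \<subseteq> U\<^sub>2 \<and> U\<^sub>1 \<noteq> U\<^sub>2"
    if block: "isolating_block M \<phi> K N" and N: "N = pos_part \<phi> N \<union> neg_part \<phi> N"
      and C: "C\<^sub>1\<in>components_in M (M frontier_of N)" "C\<^sub>2\<in>components_in M (M frontier_of N)" "C\<^sub>1 \<noteq> C\<^sub>2"
    for N C\<^sub>1 C\<^sub>2
  proof -
    have "isolated_flow M \<phi> K N"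
      using block iso haus fl
      by (simp add: isolated_flow_def isolating_block_def isolated_invariant_set_def)
    from isolated_flow.frontier_components_in_different_complement_components
      [OF this lift norm lpc K block N C] show ?thesis .
  qed
  then show "(\<nexists>x. dissonant_point M \<phi> K x) \<and>
      (\<forall>U\<in>components_in M (topspace M - K).
         locally_attracted M \<phi> K U \<or> locally_repelled M \<phi> K U) \<and>
      (\<forall>N. isolating_block M \<phi> K N \<and> N = pos_part \<phi> N \<union> neg_part \<phi> N \<longrightarrow>
         (\<forall>C\<^sub>1\<in>components_in M (M frontier_of N). \<forall>C\<^sub>2\<in>components_in M (M frontier_of N).
            C\<^sub>1 \<noteq> C\<^sub>2 \<longrightarrow>
            (\<exists>U\<^sub>1\<in>components_in M (topspace M - K). \<exists>U\<^sub>2\<in>components_in M (topspace M - K).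
               C\<^sub>1 \<subseteq> U\<^sub>1 \<and> C\<^sub>2 \<subseteq> U\<^sub>2 \<and> U\<^sub>1 \<noteq> U\<^sub>2)))"
    by (intro conjI local_part allI impI ballI) (elim conjE, assumption?)+
next
  fix n :: nat and \<phi> K
  let ?E = "Euclidean_space n"
  assume asm: "2 \<le> n \<and> flow ?E \<phi> \<and> isolated_invariant_set ?E \<phi> K \<and> nonsaddle_set ?E \<phi> K \<and>
      connectedin ?E K"
  then have K: "connectedin ?E K" "K \<noteq> {}" "K \<noteq> topspace ?E" and ns: "nonsaddle_set ?E \<phi> K"
    and n: "2 \<le> n" and fl: "flow ?E \<phi>" and iso: "isolated_invariant_set ?E \<phi> K"
    by (auto simp: isolated_invariant_set_def)
  obtain N where N: "isolated_flow ?E \<phi> K N"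
    using isolated_flow_if_isolated_invariant_set[OF Hausdorff_Euclidean_space fl iso] .
  show "(\<nexists>x. dissonant_point ?E \<phi> K x) \<and>
      (\<forall>U\<in>components_in ?E (topspace ?E - K). locally_attracted ?E \<phi> K U \<or> locally_repelled ?E \<phi> K U) \<and>
      (influence_region ?E \<phi> K = topspace ?E \<longrightarrow>
         stable_global_attractor ?E \<phi> K \<or> neg_stable_global_repeller ?E \<phi> K)"
    using isolated_flow.no_dissonance_and_local_attraction_or_repulsion[OF N
        circle_lifting_Euclidean_space metrizable_imp_normal_space[OF metrizable_Euclidean_space]
        locally_path_connected_Euclidean_space K(1,2) ns]
      Euclidean_global_attractor_or_repeller[OF n N K ns]
    by (intro conjI impI)
qed

end
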